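(* For every $d,\alpha>0$ there exist $\rho>0$ and $n_0$ such that every $3$-uniform hypergraph $H$ on $n\geq n_0$ vertices which is $(\rho,d)$-dense in the (pair, pair) sense and satisfies $\delta_1(H)\geq\alpha\binom{n}{2}$ contains a tight Hamilton cycle.
   Context: For a $3$-uniform hypergraph $H=(V,E)$, $\delta_1(H)$ denotes the minimum vertex degree, i.e. the minimum over $v\in V$ of the number of edges of $H$ containing $v$. Density: for $\rho,d\in(0,1]$, a $3$-uniform hypergraph $H=(V,E)$ on $n$ vertices is $(\rho,d)$-dense in the (pair, pair) sense if for every two collections of ordered pairs $P,Q\subseteq V\times V$ we have $$|\{((x,y),(y,z))\in P\times Q\colon \{x,y,z\}\in E\}|\geq d\,|\{((x,y),(y,z))\in P\times Q\}|-\rho n^3.$$ A tight path is an ordered set of distinct vertices $(v_1,\dots,v_\ell)$ such that every three consecutive vertices form an edge. A tight path $v_1v_2\dots v_\ell$ together with the edges $v_{\ell-1}v_\ell v_1$ and $v_\ell v_1v_2$ forms a tight cycle. A tight Hamilton cycle is a tight cycle covering all vertices of the hypergraph. *)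

theory Defs
  imports Complex_Main
begin

definition uniform3_hypergraph :: "'a set \<Rightarrow> 'a set set \<Rightarrow> bool" where
  "uniform3_hypergraph V E \<longleftrightarrow> finite V \<and> (\<forall>e\<in>E. e \<subseteq> V \<and> card e = 3)"

definition vertex_degree :: "'a set set \<Rightarrow> 'a \<Rightarrow> nat" where
  "vertex_degree E v = card {e \<in> E. v \<in> e}"

text \<open>Meaningful only for finite nonempty vertex sets, as \<^const>\<open>Min\<close> is unspecified on the
  empty set.\<close>

definition min_vertex_degree :: "'a set \<Rightarrow> 'a set set \<Rightarrow> nat" where
  "min_vertex_degree V E = Min (vertex_degree E ` V)"

text \<open>The ranges of \<open>\<rho>\<close> and \<open>d\<close> are deliberately not part of the predicate: a range condition on
  \<open>\<rho>\<close> here would let an existentially chosen \<open>\<rho>\<close> outside the range make the predicate false.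
  The collections \<open>P\<close> and \<open>Q\<close> may contain diagonal pairs \<open>(x, x)\<close>.\<close>

definition pair_pair_dense :: "real \<Rightarrow> real \<Rightarrow> 'a set \<Rightarrow> 'a set set \<Rightarrow> bool" where
  "pair_pair_dense \<rho> d V E \<longleftrightarrow>
     (\<forall>P Q. P \<subseteq> V \<times> V \<and> Q \<subseteq> V \<times> V \<longrightarrow>
        real (card {((x, y), (y, z)) | x y z. (x, y) \<in> P \<and> (y, z) \<in> Q \<and> {x, y, z} \<in> E})
        \<ge> d * real (card {((x, y), (y, z)) | x y z. (x, y) \<in> P \<and> (y, z) \<in> Q})
            - \<rho> * real (card V) ^ 3)"

definition tight_path :: "'a set \<Rightarrow> 'a set set \<Rightarrow> 'a list \<Rightarrow> bool" where
  "tight_path V E vs \<longleftrightarrow> distinct vs \<and> set vs \<subseteq> V \<and>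
     (\<forall>i. i + 2 < length vs \<longrightarrow> {vs ! i, vs ! (i + 1), vs ! (i + 2)} \<in> E)"

text \<open>The length condition keeps all list indices within bounds. In a 3-uniform hypergraph the
  closing edges force at least three vertices anyway.\<close>

definition tight_cycle :: "'a set \<Rightarrow> 'a set set \<Rightarrow> 'a list \<Rightarrow> bool" where
  "tight_cycle V E vs \<longleftrightarrow> tight_path V E vs \<and> 3 \<le> length vs \<and>
     {vs ! (length vs - 2), vs ! (length vs - 1), vs ! 0} \<in> E \<and>
     {vs ! (length vs - 1), vs ! 0, vs ! 1} \<in> E"

definition tight_Hamilton_cycle :: "'a set \<Rightarrow> 'a set set \<Rightarrow> 'a list \<Rightarrow> bool" where
  "tight_Hamilton_cycle V E vs \<longleftrightarrow> tight_cycle V E vs \<and> set vs = V"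

end

theory Submission
  imports Defs "HOL-Library.Multiset"
begin

text \<open>
  The proof uses the absorption method, without regularity and without probability. By density, all
  but \<open>O(\<rho> n\<^sup>2)\<close> pairs are ``good'': both endpoints are typical and the codegree is linear. Any two
  good pairs are joined by \<open>\<Omega>(n\<^sup>4)\<close> tight paths with four inner vertices: two steps from either pair
  reach \<open>\<Omega>(n\<^sup>2)\<close> pairs, and density links these two families. Applied to the link graph of a vertex
  \<open>v\<close>, which has \<open>\<Omega>(n\<^sup>2)\<close> edges by the degree condition, the same counting gives \<open>\<Omega>(n\<^sup>4)\<close> absorbers:
  tight paths \<open>a b c e\<close> for which \<open>a b v c e\<close> is also a tight path.

  A greedy selection yields a small linear family of disjoint absorbers serving every vertex
  linearly often, which connectors join to one tight path \<open>A\<close>, and a small reservoir \<open>R\<close> which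
  connects any two good pairs many times. The remaining vertices are covered, up to a small
  proportion, by boundedly many tight paths of linear length, because every linear-sized set of
  vertices induces a hypergraph of positive density. These paths and \<open>A\<close> are connected to a cycle
  through \<open>R\<close>, and all vertices left over are absorbed by \<open>A\<close>.
\<close>

section \<open>Tight walks, absorption and connection\<close>

text \<open>Distinctness and membership in \<open>V\<close> are left out, so that walks can be cut,
  glued and spliced as plain lists; both are tracked separately.\<close>

fun tight_walk :: "'a set set \<Rightarrow> 'a list \<Rightarrow> bool" where
  "tight_walk E (x # y # z # r) \<longleftrightarrow> {x, y, z} \<in> E \<and> tight_walk E (y # z # r)"
| "tight_walk E _ \<longleftrightarrow> True"

lemma tight_walk_nth:
  "tight_walk E xs \<longleftrightarrow> (\<forall>i. i + 2 < length xs \<longrightarrow> {xs ! i, xs ! (i + 1), xs ! (i + 2)} \<in> E)"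
proof (induction E xs rule: tight_walk.induct)
  case (1 E x y z r)
  show ?case (is "_ = (\<forall>i. ?P i)")
  proof -
    have "(\<forall>i. ?P i) \<longleftrightarrow> ?P 0 \<and> (\<forall>i. ?P (Suc i))"
      by (metis not0_implies_Suc)
    then show ?thesis using 1 by simp
  qed
qed auto

text \<open>No triple of consecutive vertices reaches across an overlap of two, so each one lies
  inside one of the two parts.\<close>

lemma tight_walk_glue:
  "tight_walk E (xs @ a # b # ys) \<longleftrightarrow> tight_walk E (xs @ [a, b]) \<and> tight_walk E (a # b # ys)"
proof (induction xs)
  case Nil
  then show ?case by simp
next
  case (Cons x xs)
  show ?case
  proof (cases xs)
    case Nil
    then show ?thesis by simp
  next
    case (Cons x' xs')
    then show ?thesis using Cons.IH by (cases xs') auto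
  qed
qed

text \<open>Appending \<open>take 2 vs\<close> turns the two closing edges into ordinary consecutive
  triples, so the cyclic condition becomes one on a walk.\<close>

lemma tight_Hamilton_cycleI:
  assumes "tight_walk E (vs @ take 2 vs)" "distinct vs" "set vs = V" "3 \<le> length vs"
  shows "tight_Hamilton_cycle V E vs"
proof -
  have nth: "{(vs @ take 2 vs) ! i, (vs @ take 2 vs) ! (i + 1), (vs @ take 2 vs) ! (i + 2)} \<in> E"
    if "i + 2 < length vs + 2" for i
    using assms(1,4) that unfolding tight_walk_nth by (auto simp: min_def)
  have "{vs ! i, vs ! (i + 1), vs ! (i + 2)} \<in> E" if "i + 2 < length vs" for i
    using nth[of i] that by (simp add: nth_append)
  moreover have "{vs ! (length vs - 2), vs ! (length vs - 1), vs ! 0} \<in> E"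
  proof -
    have "length vs - 2 + 1 = length vs - 1" "length vs - 2 + 2 = length vs"
      using assms(4) by auto
    then show ?thesis
      using nth[of "length vs - 2"] assms(4) by (simp add: nth_append)
  qed
  moreover have "{vs ! (length vs - 1), vs ! 0, vs ! 1} \<in> E"
  proof -
    have "length vs - 1 + 1 = length vs" "length vs - 1 + 2 = length vs + 1"
      using assms(4) by auto
    then show ?thesis
      using nth[of "length vs - 1"] assms(4) by (simp add: nth_append)
  qed
  ultimately show ?thesis
    using assms unfolding tight_Hamilton_cycle_def tight_cycle_def tight_path_def by auto
qed

section \<open>Absorbing vertices into a tight walk\<close>

text \<open>Both forms of the block start with \<open>a, b\<close> and end with \<open>c, e\<close>,
  which is all that the edges leaving the block can see.\<close>

definition absorbs :: "'a set set \<Rightarrow> 'a \<Rightarrow> 'a list \<Rightarrow> bool" where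
  "absorbs E v t \<longleftrightarrow> (\<exists>a b c e. t = [a, b, c, e] \<and> tight_walk E t \<and> tight_walk E [a, b, v, c, e])"

lemma absorb_one:
  assumes "absorbs E v t" "tight_walk E (p @ t @ q)"
  obtains t' where "mset t' = mset (v # t)" "tight_walk E (p @ t' @ q)"
proof -
  obtain a b c e where t: "t = [a, b, c, e]" "tight_walk E [a, b, v, c, e]"
    using assms(1) unfolding absorbs_def by auto
  have w: "tight_walk E (p @ [a, b])" "tight_walk E (c # e # q)"
    using assms(2) unfolding t
    using tight_walk_glue[of E p a b "c # e # q"] tight_walk_glue[of E "[a, b]" c e q] by auto
  have "tight_walk E ([a, b, v] @ c # e # q)"
    using w(2) t(2) by (subst tight_walk_glue) simp
  then have "tight_walk E (p @ a # b # v # c # e # q)"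
    using w(1) by (subst tight_walk_glue) simp
  then show thesis
    using that[of "[a, b, v, c, e]"] t(1) by simp
qed

text \<open>Absorption works on a list of blocks, so that replacing the block \<open>[a, b, c, e]\<close> by
  \<open>[a, b, v, c, e]\<close> leaves all other absorbers in place.\<close>

lemma absorb_many:
  assumes "finite L" "finite \<T>" "\<T> \<subseteq> set Bs"
    and "\<And>v. v \<in> L \<Longrightarrow> card L \<le> card {t \<in> \<T>. absorbs E v t}"
    and "tight_walk E (p @ concat Bs @ q)"
  shows "\<exists>xs. mset xs = mset (concat Bs) + mset_set L \<and> tight_walk E (p @ xs @ q)"
  using assms
proof (induction L arbitrary: \<T> Bs rule: finite_induct)
  case empty
  then show ?case by (intro exI[of _ "concat Bs"]) simp
next
  case (insert v L)
  have "card (insert v L) \<le> card {t \<in> \<T>. absorbs E v t}"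
    using insert.prems(3)[of v] by simp
  then have "{t \<in> \<T>. absorbs E v t} \<noteq> {}"
    using insert.hyps by (metis card.empty card_insert_disjoint not_less_eq_eq zero_le)
  then obtain t where t: "t \<in> \<T>" "absorbs E v t" by auto
  obtain Xs Ys where Bs: "Bs = Xs @ t # Ys"
    using t insert.prems(2) by (meson in_mono split_list)
  have "tight_walk E ((p @ concat Xs) @ t @ (concat Ys @ q))"
    using insert.prems(4) Bs by simp
  then obtain t' where t': "mset t' = mset (v # t)"
      "tight_walk E ((p @ concat Xs) @ t' @ (concat Ys @ q))"
    using absorb_one[OF t(2)] by metis
  have "\<exists>xs. mset xs = mset (concat (Xs @ t' # Ys)) + mset_set L \<and> tight_walk E (p @ xs @ q)"
  proof (rule insert.IH[of "\<T> - {t}"])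
    fix u assume u: "u \<in> L"
    \<comment> \<open>Spending \<open>t\<close> costs each remaining vertex at most one absorber,
      while the set still to be absorbed also shrinks by one.\<close>
    have "card {t \<in> \<T>. absorbs E u t} \<le> Suc (card {s \<in> \<T> - {t}. absorbs E u s})"
    proof -
      have "{t \<in> \<T>. absorbs E u t} \<subseteq> insert t {s \<in> \<T> - {t}. absorbs E u s}" by auto
      then have "card {t \<in> \<T>. absorbs E u t} \<le> card (insert t {s \<in> \<T> - {t}. absorbs E u s})"
        using insert.prems(1) by (intro card_mono) auto
      then show ?thesis using insert.prems(1) by (simp add: card_insert_if split: if_splits)
    qed
    then show "card L \<le> card {s \<in> \<T> - {t}. absorbs E u s}"
      using insert.prems(3)[of u] insert.hyps u by simp
  qed (use insert.prems Bs t' in auto)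
  then show ?case
    using t' insert.hyps by (auto simp: Bs)
qed

section \<open>Connecting walks through a reservoir\<close>

text \<open>A robust form of connectability: \<open>X\<close> stands for the vertices already spent,
  so \<open>k\<close> is the budget for successive connections.\<close>

definition supplies ::
    "'a set set \<Rightarrow> ('a \<Rightarrow> 'a \<Rightarrow> bool) \<Rightarrow> 'a set \<Rightarrow> nat \<Rightarrow> bool" where
  "supplies E good R k \<longleftrightarrow> (\<forall>a b c e X. good a b \<and> good c e \<and> finite X \<and> card X \<le> k \<longrightarrow>
     (\<exists>t. length t = 4 \<and> distinct t \<and> set t \<subseteq> R - X \<and> tight_walk E (a # b # t @ [c, e])))"

text \<open>The two decompositions may overlap, so a list of just two vertices can qualify.\<close>

definition good_ends :: "('a \<Rightarrow> 'a \<Rightarrow> bool) \<Rightarrow> 'a list \<Rightarrow> bool" where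
  "good_ends good p \<longleftrightarrow> (\<exists>a b xs c e ys. p = a # b # xs \<and> p = ys @ [c, e] \<and> good a b \<and> good c e)"

lemma supplies_connect:
  assumes "supplies E good R k" "good_ends good p" "good_ends good q"
    and "tight_walk E p" "tight_walk E q" "finite X" "card X \<le> k"
  obtains t where "length t = 4" "distinct t" "set t \<subseteq> R - X" "tight_walk E (p @ t @ q)"
proof -
  obtain c e ys where p: "p = ys @ [c, e]" "good c e"
    using assms(2) unfolding good_ends_def by auto
  obtain a b xs where q: "q = a # b # xs" "good a b"
    using assms(3) unfolding good_ends_def by auto
  obtain t where t: "length t = 4" "distinct t" "set t \<subseteq> R - X"
      "tight_walk E (c # e # t @ [a, b])"
    using assms(1,6,7) p(2) q(2) unfolding supplies_def by metis
  have "tight_walk E ((c # e # t) @ a # b # xs)"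
    using t(4) assms(5) q(1) by (subst tight_walk_glue) simp
  then have "tight_walk E (ys @ c # e # (t @ a # b # xs))"
    using assms(4) p(1) by (subst tight_walk_glue) simp
  then show thesis using that[of t] t p q by simp
qed

text \<open>The blocks are linked from last to first, each connector avoiding the vertices of
  \<open>R\<close> spent before, at most four per block. Connectors become blocks of
  \<open>Ds\<close> themselves, so the original blocks survive intact for later absorption.\<close>

lemma join_blocks:
  assumes "Bs \<noteq> []"
    and "\<And>B. B \<in> set Bs \<Longrightarrow> tight_walk E B \<and> good_ends good B"
    and "distinct (concat Bs)" "set (concat Bs) \<inter> R = {}"
    and "supplies E good R k" "4 * length Bs \<le> k"
  shows "\<exists>Ds. set Bs \<subseteq> set Ds \<and> distinct (concat Ds) \<and> tight_walk E (concat Ds) \<and>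
    good_ends good (concat Ds) \<and> set (concat Ds) \<subseteq> set (concat Bs) \<union> R \<and>
    card (set (concat Ds) \<inter> R) \<le> 4 * length Bs"
  using assms
proof (induction Bs rule: list_nonempty_induct)
  case (single B)
  then show ?case by (intro exI[of _ "[B]"]) auto
next
  case (cons B Bs)
  obtain Ds where Ds: "set Bs \<subseteq> set Ds" "distinct (concat Ds)" "tight_walk E (concat Ds)"
    "good_ends good (concat Ds)" "set (concat Ds) \<subseteq> set (concat Bs) \<union> R"
    "card (set (concat Ds) \<inter> R) \<le> 4 * length Bs"
    using cons by fastforce
  let ?X = "set (concat Ds) \<inter> R"
  have "card ?X \<le> k" using cons.prems(5) Ds(6) by simp
  then obtain t where t: "length t = 4" "distinct t" "set t \<subseteq> R - ?X"
      "tight_walk E (B @ t @ concat Ds)"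
    using supplies_connect[OF cons.prems(4) _ Ds(4), of B ?X] cons.prems(1) Ds(3) by auto
  have "good_ends good (B @ t @ concat Ds)"
    using cons.prems(1)[of B] Ds(4) unfolding good_ends_def by simp (metis append_Cons append_assoc)
  moreover have "distinct (B @ t @ concat Ds)"
  proof -
    have "set t \<inter> set (concat Ds) = {}" "set t \<inter> set B = {}"
      using t(3) cons.prems(3) by auto
    moreover have "set B \<inter> set (concat Ds) = {}"
      using Ds(5) cons.prems(2,3) by (auto simp del: set_concat)
    ultimately show ?thesis
      using t(2) Ds(2) cons.prems(2) by (auto simp del: set_concat)
  qed
  moreover have "set (B @ t @ concat Ds) \<subseteq> set (concat (B # Bs)) \<union> R"
    using t Ds(5) by auto
  moreover have "card (set (B @ t @ concat Ds) \<inter> R) \<le> 4 * length (B # Bs)"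
  proof -
    have "set (B @ t @ concat Ds) \<inter> R \<subseteq> set t \<union> ?X" using cons.prems(3) by auto
    then have "card (set (B @ t @ concat Ds) \<inter> R) \<le> card (set t \<union> ?X)"
      by (intro card_mono) auto
    also have "\<dots> \<le> card (set t) + card ?X" by (rule card_Un_le)
    finally show ?thesis using Ds(6) t(1) card_length[of t] by simp
  qed
  ultimately show ?case
    using t Ds(1) by (intro exI[of _ "B # t # Ds"]) (auto simp del: set_concat)
qed

text \<open>The connector from the end of \<open>p\<close> back to its start is placed first. Its
  own first two vertices then close the cycle, even after vertices have been absorbed inside
  \<open>p\<close>.\<close>

lemma close_cycle:
  assumes "supplies E good R k" "good_ends good p" "tight_walk E p" "distinct p"
    and "card (set p \<inter> R) \<le> k"
  obtains t where "length t = 4" "distinct (t @ p)" "set t \<subseteq> R" "tight_walk E (t @ p @ take 2 t)"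
proof -
  obtain t where t: "length t = 4" "distinct t" "set t \<subseteq> R - (set p \<inter> R)" "tight_walk E (p @ t @ p)"
    using supplies_connect[OF assms(1,2,2,3,3) _ assms(5)] by auto
  obtain x y z w where txy: "t = [x, y, z, w]"
    using t(1) by (auto simp: length_Suc_conv eval_nat_numeral)
  obtain c e ys where p: "p = ys @ [c, e]"
    using assms(2) unfolding good_ends_def by auto
  \<comment> \<open>The walk \<open>p @ t @ p\<close> contains \<open>p\<close> followed by
    \<open>x, y\<close>, and \<open>t\<close> followed by \<open>p\<close>; gluing these at the last
    pair of \<open>p\<close> removes the repetition.\<close>
  have 1: "tight_walk E (p @ x # y # (z # w # p))"
    using t(4) txy by simp
  then have "tight_walk E (p @ [x, y])" "tight_walk E (x # y # z # w # p)"
    using tight_walk_glue[of E p x y "z # w # p"] by blast+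
  then have "tight_walk E (c # e # [x, y])" "tight_walk E ((t @ ys) @ [c, e])"
    using tight_walk_glue[of E ys c e "[x, y]"] unfolding p txy by simp_all
  then have "tight_walk E ((t @ ys) @ c # e # [x, y])"
    using tight_walk_glue[of E "t @ ys" c e "[x, y]"] by simp
  then have "tight_walk E (t @ p @ take 2 t)"
    unfolding p txy by simp
  then show thesis using that[of t] t assms(4) by auto
qed

section \<open>Greedy selection of disjoint tuples\<close>

text \<open>Of the \<open>n^r\<close> lists over \<open>V\<close>, \<open>(n - f)^r\<close> avoid
  \<open>F\<close>, where \<open>f\<close> counts the elements of \<open>F\<close> in
  \<open>V\<close>; Bernoulli's inequality bounds the difference.\<close>

lemma few_lists_meet:
  assumes "finite V" "V \<noteq> {}" "finite F"
  shows "real (card {l. set l \<subseteq> V \<and> length l = r \<and> set l \<inter> F \<noteq> {}})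
    \<le> real r * real (card F) / real (card V) * real (card V) ^ r"
proof -
  let ?n = "real (card V)" and ?f = "card (V \<inter> F)"
  let ?A = "{l. set l \<subseteq> V \<and> length l = r}" and ?B = "{l. set l \<subseteq> V - F \<and> length l = r}"
  have n: "?n > 0" using assms by (simp add: card_gt_0_iff)
  have fV: "?f \<le> card V" "?f \<le> card F" using assms by (auto intro: card_mono)
  have eq: "{l. set l \<subseteq> V \<and> length l = r \<and> set l \<inter> F \<noteq> {}} = ?A - ?B" by auto
  have cA: "card ?A = card V ^ r" and cB: "card ?B = card (V - F) ^ r"
    using assms by (auto intro: card_lists_length_eq)
  have VF: "real (card (V - F)) = ?n - ?f"
    using fV(1) assms by (simp add: card_Diff_subset_Int)
  have "real (card (?A - ?B)) = real (card ?A) - real (card ?B)"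
  proof -
    have "finite ?A" using assms(1) by (rule finite_lists_length_eq)
    moreover have "?B \<subseteq> ?A" by auto
    ultimately show ?thesis
      by (simp add: card_Diff_subset finite_subset card_mono)
  qed
  also have "\<dots> = ?n ^ r - (?n - ?f) ^ r" using cA cB VF by simp
  also have "(?n - ?f) ^ r = ?n ^ r * (1 + (- (?f / ?n))) ^ r"
    using n by (simp add: power_mult_distrib[symmetric] field_simps)
  also have "?n ^ r - \<dots> \<le> ?n ^ r - ?n ^ r * (1 + real r * (- (?f / ?n)))"
    using n fV(1) by (intro diff_left_mono mult_left_mono Bernoulli_inequality) auto
  also have "\<dots> = real r * ?f / ?n * ?n ^ r" by (simp add: algebra_simps)
  also have "\<dots> \<le> real r * real (card F) / ?n * ?n ^ r"
    using fV(2) by (intro mult_right_mono divide_right_mono mult_left_mono) auto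
  finally show ?thesis using eq by simp
qed

text \<open>A derandomised choice of random \<open>r\<close>-tuples: the potential \<open>\<Sum>i. 2 ^ - hits i\<close> is reduced by a
  constant factor in every round.\<close>

lemma greedy_selection:
  fixes S :: "'i \<Rightarrow> 'a list set"
  assumes "finite V" "V \<noteq> {}" "finite I" "finite F" "0 < \<kappa>" "0 < r"
    and S: "\<And>i. i \<in> I \<Longrightarrow> S i \<subseteq> {l. set l \<subseteq> V \<and> length l = r}"
    and large: "\<And>i. i \<in> I \<Longrightarrow> 2 * \<kappa> * real (card V) ^ r \<le> real (card (S i))"
    and "real r * (real (card F) + real r * real m) \<le> \<kappa> * real (card V)"
  obtains \<T> where "finite \<T>" "card \<T> \<le> m" "\<T> \<subseteq> (\<Union>i\<in>I. S i)"
    "\<And>s t. s \<in> \<T> \<Longrightarrow> t \<in> \<T> \<Longrightarrow> s \<noteq> t \<Longrightarrow> set s \<inter> set t = {}"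
    "\<And>t. t \<in> \<T> \<Longrightarrow> set t \<inter> F = {}"
    "(\<Sum>i\<in>I. (1 / 2) ^ card (\<T> \<inter> S i)) \<le> real (card I) * (1 - \<kappa> / 2) ^ m"
proof -
  have "\<exists>\<T>. finite \<T> \<and> card \<T> \<le> m \<and> \<T> \<subseteq> (\<Union>i\<in>I. S i) \<and>
    (\<forall>s\<in>\<T>. \<forall>t\<in>\<T>. s \<noteq> t \<longrightarrow> set s \<inter> set t = {}) \<and> (\<forall>t\<in>\<T>. set t \<inter> F = {}) \<and>
    (\<Sum>i\<in>I. (1 / 2) ^ card (\<T> \<inter> S i)) \<le> real (card I) * (1 - \<kappa> / 2) ^ m"
    using assms(9)
  proof (induction m)
    case 0
    then show ?case by (intro exI[of _ "{}"]) simp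
  next
    case (Suc m)
    let ?n = "real (card V)" and ?N = "real (card V) ^ r"
    have n: "?n > 0" using assms by (simp add: card_gt_0_iff)
    have "real r * (real (card F) + real r * real m) \<le> real r * (real (card F) + real r * real (Suc m))"
      by (intro mult_left_mono add_left_mono) auto
    with Suc.prems have bd: "real r * (real (card F) + real r * real m) \<le> \<kappa> * ?n" by linarith
    from Suc.IH[OF bd] obtain \<T> where T: "finite \<T>" "card \<T> \<le> m" "\<T> \<subseteq> (\<Union>i\<in>I. S i)"
      "\<forall>s\<in>\<T>. \<forall>t\<in>\<T>. s \<noteq> t \<longrightarrow> set s \<inter> set t = {}" "\<forall>t\<in>\<T>. set t \<inter> F = {}"
      "(\<Sum>i\<in>I. (1 / 2) ^ card (\<T> \<inter> S i)) \<le> real (card I) * (1 - \<kappa> / 2) ^ m" by blast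
    show ?case
    proof (cases "I = {}")
      case True
      then show ?thesis by (intro exI[of _ "{}"]) simp
    next
      case False
      \<comment> \<open>\<open>w i\<close> is the current term of the potential; a new tuple in
        \<open>S i\<close> halves it.\<close>
      define w :: "'i \<Rightarrow> real" where "w i = (1 / 2) ^ card (\<T> \<inter> S i)" for i
      define W where "W = (\<Sum>i\<in>I. w i)"
      have w0: "w i > 0" for i unfolding w_def by simp
      have W0: "W > 0" unfolding W_def using w0 False assms(3) by (intro sum_pos) auto
      \<comment> \<open>The vertices now forbidden: those of \<open>F\<close> and of all tuples
        chosen so far, at most \<open>card F + r * m\<close> in number.\<close>
      define F' where "F' = F \<union> (\<Union>t\<in>\<T>. set t)"
      have lenT: "card (set t) \<le> r" if "t \<in> \<T>" for t
        using that T(3) S card_length[of t] by fastforce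
      have "card (\<Union>t\<in>\<T>. set t) \<le> (\<Sum>t\<in>\<T>. card (set t))"
        using T(1) by (intro card_UN_le)
      also have "\<dots> \<le> (\<Sum>t\<in>\<T>. r)" by (intro sum_mono lenT)
      also have "\<dots> \<le> r * m" using T(2) by simp
      finally have "card F' \<le> card F + r * m"
        unfolding F'_def using card_Un_le[of F "\<Union>t\<in>\<T>. set t"] by linarith
      then have "real (card F') \<le> real (card F) + real r * real m"
        by (metis of_nat_add of_nat_le_iff of_nat_mult)
      then have "real r * real (card F') \<le> \<kappa> * ?n"
        using bd mult_left_mono[of "real (card F')" "real (card F) + real r * real m" "real r"] by linarith
      then have "real r * real (card F') / ?n \<le> \<kappa>" using n by (simp add: divide_le_eq)
      then have F'b: "real r * real (card F') / ?n * ?N \<le> \<kappa> * ?N"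
        by (intro mult_right_mono) auto
      have finF': "finite F'" unfolding F'_def using T(1) assms(4) by auto
      define L where "L = {l. set l \<subseteq> V \<and> length l = r \<and> set l \<inter> F' = {}}"
      have finA: "finite {l. set l \<subseteq> V \<and> length l = r}" using assms(1) by (rule finite_lists_length_eq)
      have finL: "finite L" using finA unfolding L_def by (rule rev_finite_subset) auto
      have cardL: "real (card L) \<le> ?N"
      proof -
        have "card L \<le> card {l. set l \<subseteq> V \<and> length l = r}"
          unfolding L_def using finA by (intro card_mono) auto
        then show ?thesis using card_lists_length_eq[OF assms(1), of r]
          by (metis of_nat_le_iff of_nat_power)
      qed
      \<comment> \<open>At most \<open>\<kappa> * n^r\<close> lists meet \<open>F'\<close>, so half
        of the guaranteed number of tuples in \<open>S i\<close> is still available.\<close>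
      have SL: "\<kappa> * ?N \<le> real (card (L \<inter> S i))" if "i \<in> I" for i
      proof -
        let ?M = "{l. set l \<subseteq> V \<and> length l = r \<and> set l \<inter> F' \<noteq> {}}"
        have "finite ?M" using finA by (rule rev_finite_subset) auto
        then have "card (S i) \<le> card ((L \<inter> S i) \<union> ?M)"
          using S[OF that] finL by (intro card_mono) (auto simp: L_def)
        also have "\<dots> \<le> card (L \<inter> S i) + card ?M" by (rule card_Un_le)
        finally have "real (card (S i)) \<le> real (card (L \<inter> S i)) + real (card ?M)" by linarith
        then show ?thesis
          using few_lists_meet[OF assms(1,2) finF', of r] F'b large[OF that] by linarith
      qed
      \<comment> \<open>Averaging over \<open>L\<close>: each index is hit by at least
        \<open>\<kappa> * n^r\<close> of the at most \<open>n^r\<close> tuples, so some tuple hits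
        indices carrying a \<open>\<kappa>\<close> share of the weight.\<close>
      have "\<exists>t\<in>L. \<kappa> * W \<le> (\<Sum>i\<in>I. if t \<in> S i then w i else 0)"
      proof (rule ccontr)
        assume "\<not> ?thesis"
        then have lt: "(\<Sum>i\<in>I. if t \<in> S i then w i else 0) < \<kappa> * W" if "t \<in> L" for t
          using that by force
        have NW: "\<kappa> * ?N * W > 0" using assms(5) n W0 by simp
        have "\<kappa> * ?N * W = (\<Sum>i\<in>I. \<kappa> * ?N * w i)" unfolding W_def by (simp add: sum_distrib_left)
        also have "\<dots> \<le> (\<Sum>i\<in>I. real (card (L \<inter> S i)) * w i)"
          using SL w0 by (intro sum_mono mult_right_mono) (auto intro: less_imp_le)
        also have "\<dots> = (\<Sum>i\<in>I. \<Sum>t\<in>L. if t \<in> S i then w i else 0)"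
          using finL by (simp add: sum.If_cases Int_def)
        also have "\<dots> = (\<Sum>t\<in>L. \<Sum>i\<in>I. if t \<in> S i then w i else 0)" by (rule sum.swap)
        finally have le: "\<kappa> * ?N * W \<le> (\<Sum>t\<in>L. \<Sum>i\<in>I. if t \<in> S i then w i else 0)" .
        then have "L \<noteq> {}" using NW by auto
        then have "(\<Sum>t\<in>L. \<Sum>i\<in>I. if t \<in> S i then w i else 0) < (\<Sum>t\<in>L. \<kappa> * W)"
          using finL lt by (intro sum_strict_mono) auto
        also have "\<dots> = real (card L) * (\<kappa> * W)" by simp
        also have "\<dots> \<le> ?N * (\<kappa> * W)" using cardL assms(5) W0 by (intro mult_right_mono) auto
        finally show False using le by (simp add: algebra_simps)
      qed
      then obtain t where t: "t \<in> L" "\<kappa> * W \<le> (\<Sum>i\<in>I. if t \<in> S i then w i else 0)" by blast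
      have tU: "t \<in> (\<Union>i\<in>I. S i)"
      proof (rule ccontr)
        assume "\<not> ?thesis"
        then have "(\<Sum>i\<in>I. if t \<in> S i then w i else 0) = 0" by (intro sum.neutral) auto
        moreover have "\<kappa> * W > 0" using W0 assms(5) by simp
        ultimately show False using t(2) by linarith
      qed
      have tne: "set t \<noteq> {}" using t(1) assms(6) unfolding L_def by auto
      have tT: "set t \<inter> set s = {}" if "s \<in> \<T>" for s
        using that t(1) unfolding L_def F'_def by blast
      then have tnT: "t \<notin> \<T>" using tne by fastforce
      have "(\<Sum>i\<in>I. (1 / 2) ^ card (insert t \<T> \<inter> S i))
          = (\<Sum>i\<in>I. w i - 1 / 2 * (if t \<in> S i then w i else 0))"
        using tnT T(1) by (intro sum.cong refl) (auto simp: w_def Int_insert_left)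
      also have "\<dots> = W - 1 / 2 * (\<Sum>i\<in>I. if t \<in> S i then w i else 0)"
        unfolding W_def by (simp only: sum_subtractf sum_distrib_left)
      also have "\<dots> \<le> (1 - \<kappa> / 2) * W" using t(2) by (simp add: algebra_simps)
      finally have le: "(\<Sum>i\<in>I. (1 / 2) ^ card (insert t \<T> \<inter> S i)) \<le> (1 - \<kappa> / 2) * W" .
      \<comment> \<open>The sign is read off from the new potential, which is nonnegative and at
        most \<open>(1 - \<kappa> / 2) * W\<close>.\<close>
      have "0 \<le> 1 - \<kappa> / 2"
      proof -
        have "0 \<le> (\<Sum>i\<in>I. (1 / 2 :: real) ^ card (insert t \<T> \<inter> S i))" by (intro sum_nonneg) auto
        with le W0 show ?thesis by (smt (verit) mult_neg_pos)
      qed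
      then have "(1 - \<kappa> / 2) * W \<le> (1 - \<kappa> / 2) * (real (card I) * (1 - \<kappa> / 2) ^ m)"
        using T(6) unfolding W_def w_def by (rule mult_left_mono[rotated])
      with le have "(\<Sum>i\<in>I. (1 / 2) ^ card (insert t \<T> \<inter> S i)) \<le> real (card I) * (1 - \<kappa> / 2) ^ Suc m"
        by (simp add: algebra_simps)
      moreover have "set t \<inter> F = {}" using t(1) unfolding L_def F'_def by blast
      moreover have "card (insert t \<T>) \<le> Suc m" using T(1,2) tnT by simp
      moreover have "\<forall>s\<in>insert t \<T>. \<forall>u\<in>insert t \<T>. s \<noteq> u \<longrightarrow> set s \<inter> set u = {}"
        using T(4) tT by (auto simp: Int_commute)
      ultimately show ?thesis
        using T(1,3,5) tU by (intro exI[of _ "insert t \<T>"]) auto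
    qed
  qed
  then show thesis
    by (elim exE conjE) (rule that, assumption, assumption, assumption, blast, blast, assumption)
qed

section \<open>Counting in dense hypergraphs\<close>

text \<open>A cherry is a pair of ordered pairs \<open>(x, y)\<close>, \<open>(y, z)\<close>.
  Density is inherited by smaller \<open>d\<close>, so \<open>d \<le> 1\<close> costs no generality;
  it allows powers of \<open>d\<close> to be compared.\<close>

locale cherry_dense =
  fixes V :: "'a set" and E :: "'a set set" and d \<rho> :: real
  assumes uniform: "uniform3_hypergraph V E"
    and d_pos: "0 < d" and d_le_1: "d \<le> 1" and rho_nonneg: "0 \<le> \<rho>"
    and dense: "pair_pair_dense \<rho> d V E"
    and V_nonempty: "V \<noteq> {}"
begin

abbreviation n :: real where "n \<equiv> real (card V)"

lemma finite_V: "finite V"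
  using uniform unfolding uniform3_hypergraph_def by simp

lemma n_pos: "n > 0"
  using finite_V V_nonempty by (simp add: card_gt_0_iff)

lemma edgeD:
  assumes "{x, y, z} \<in> E"
  shows "x \<in> V" "y \<in> V" "z \<in> V" "x \<noteq> y" "y \<noteq> z" "x \<noteq> z"
proof -
  have "{x, y, z} \<subseteq> V" "card {x, y, z} = 3"
    using assms uniform unfolding uniform3_hypergraph_def by auto
  then show "x \<in> V" "y \<in> V" "z \<in> V" "x \<noteq> y" "y \<noteq> z" "x \<noteq> z"
    by (auto simp: card_insert_if split: if_splits)
qed

lemma card_subset_V: "A \<subseteq> V \<Longrightarrow> real (card A) \<le> n"
  using finite_V by (simp add: card_mono)

lemma card_subset_VV:
  assumes "A \<subseteq> V \<times> V" shows "real (card A) \<le> n\<^sup>2"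
proof -
  have "card A \<le> card (V \<times> V)" using assms finite_V by (intro card_mono) auto
  then show ?thesis
    by (metis card_cartesian_product of_nat_le_iff of_nat_mult power2_eq_square)
qed

lemma finite_VV: "A \<subseteq> V \<times> V \<Longrightarrow> finite A"
  using finite_V by (simp add: finite_subset)

lemma card_cherries:
  assumes "Q \<subseteq> V \<times> V" "\<And>x y z. R x y z \<Longrightarrow> x \<in> V"
  shows "real (card {((x, y), (y, z)) | x y z. (y, z) \<in> Q \<and> R x y z})
    = (\<Sum>(y, z)\<in>Q. real (card {x. R x y z}))"
proof -
  have "{((x, y), (y, z)) | x y z. (y, z) \<in> Q \<and> R x y z}
      = (\<lambda>p. ((snd p, fst (fst p)), fst p)) ` (SIGMA p:Q. {x. R x (fst p) (snd p)})"
    by (auto simp: image_iff)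
  moreover have "inj_on (\<lambda>p. ((snd p, fst (fst p)), fst p)) (SIGMA p:Q. {x. R x (fst p) (snd p)})"
    by (auto simp: inj_on_def)
  moreover have "finite {x. R x y z}" for y z
    by (rule finite_subset[OF _ finite_V]) (use assms(2) in auto)
  ultimately show ?thesis
    using finite_VV[OF assms(1)] by (simp add: card_image case_prod_beta)
qed

text \<open>Grouping the cherries by their second pair turns density into a bound on extension
  counts summed over an arbitrary family \<open>Q\<close>.\<close>

lemma dense_sum:
  assumes "P \<subseteq> V \<times> V" "Q \<subseteq> V \<times> V"
  shows "d * (\<Sum>(y, z)\<in>Q. real (card {x. (x, y) \<in> P})) - \<rho> * n ^ 3
    \<le> (\<Sum>(y, z)\<in>Q. real (card {x. (x, y) \<in> P \<and> {x, y, z} \<in> E}))"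
proof -
  have "real (card {((x, y), (y, z)) | x y z. (x, y) \<in> P \<and> (y, z) \<in> Q \<and> {x, y, z} \<in> E})
     = (\<Sum>(y, z)\<in>Q. real (card {x. (x, y) \<in> P \<and> {x, y, z} \<in> E}))"
    using card_cherries[OF assms(2), of "\<lambda>x y z. (x, y) \<in> P \<and> {x, y, z} \<in> E"] assms(1)
    by (simp add: conj_commute conj_left_commute subset_iff) (auto simp: conj_commute conj_left_commute)
  moreover have "real (card {((x, y), (y, z)) | x y z. (x, y) \<in> P \<and> (y, z) \<in> Q})
     = (\<Sum>(y, z)\<in>Q. real (card {x. (x, y) \<in> P}))"
    using card_cherries[OF assms(2), of "\<lambda>x y z. (x, y) \<in> P"] assms(1)
    by (simp add: conj_commute conj_left_commute subset_iff)
  moreover note dense[unfolded pair_pair_dense_def, rule_format, of P Q, OF conjI[OF assms]]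
  ultimately show ?thesis by (simp only:)
qed

text \<open>Each pair of \<open>R\<close> falls short of its share by at least
  \<open>d * s / 2\<close>, while density with \<open>R\<close> as the second family allows a total
  shortfall of only \<open>\<rho> * n ^ 3\<close>.\<close>

lemma few_deficient_pairs:
  assumes "P \<subseteq> V \<times> V" "R \<subseteq> V \<times> V" "0 < s"
    and "\<And>y z. (y, z) \<in> R \<Longrightarrow> s \<le> real (card {x. (x, y) \<in> P})"
    and "\<And>y z. (y, z) \<in> R \<Longrightarrow>
      real (card {x. (x, y) \<in> P \<and> {x, y, z} \<in> E}) \<le> d / 2 * real (card {x. (x, y) \<in> P})"
  shows "real (card R) \<le> 2 * \<rho> * n ^ 3 / (d * s)"
proof -
  let ?C = "\<Sum>(y, z)\<in>R. real (card {x. (x, y) \<in> P})"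
  have "(\<Sum>(y, z)\<in>R. real (card {x. (x, y) \<in> P \<and> {x, y, z} \<in> E}))
      \<le> (\<Sum>(y, z)\<in>R. d / 2 * real (card {x. (x, y) \<in> P}))"
    using assms(5) by (intro sum_mono) auto
  also have "\<dots> = d / 2 * ?C" by (simp add: sum_distrib_left case_prod_beta)
  finally have "d * ?C \<le> 2 * \<rho> * n ^ 3" using dense_sum[OF assms(1,2)] by linarith
  moreover have "d * (real (card R) * s) \<le> d * ?C"
  proof -
    have "real (card R) * s = (\<Sum>(y, z)\<in>R. s)" by simp
    also have "\<dots> \<le> ?C" using assms(4) by (intro sum_mono) auto
    finally show ?thesis using d_pos by (intro mult_left_mono) auto
  qed
  ultimately have "real (card R) * (d * s) \<le> 2 * \<rho> * n ^ 3" by (simp add: algebra_simps)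
  then show ?thesis using d_pos assms(3) by (simp add: pos_le_divide_eq)
qed

text \<open>The mirror image comes for free, since edges are unordered.\<close>

lemma few_deficient_pairs':
  assumes "Q \<subseteq> V \<times> V" "R \<subseteq> V \<times> V" "0 < s"
    and "\<And>y z. (y, z) \<in> R \<Longrightarrow> s \<le> real (card {w. (z, w) \<in> Q})"
    and "\<And>y z. (y, z) \<in> R \<Longrightarrow>
      real (card {w. (z, w) \<in> Q \<and> {y, z, w} \<in> E}) \<le> d / 2 * real (card {w. (z, w) \<in> Q})"
  shows "real (card R) \<le> 2 * \<rho> * n ^ 3 / (d * s)"
proof -
  have e: "{w, z, y} = {y, z, w}" for w z y :: 'a by auto
  have "real (card (R\<inverse>)) \<le> 2 * \<rho> * n ^ 3 / (d * s)"
    by (rule few_deficient_pairs[of "Q\<inverse>"]) (use assms in \<open>auto simp: e\<close>)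
  then show ?thesis by simp
qed

text \<open>Middle pairs that extend poorly on the left or on the right are few and are discarded.
  Every other one has at least \<open>d * s / 2\<close> extensions on each side, chosen
  independently; \<open>x = w\<close> is not excluded.\<close>

lemma many_four_walks:
  assumes "P \<subseteq> V \<times> V" "Q \<subseteq> V \<times> V" "M \<subseteq> V \<times> V" "0 < s"
    and P: "\<And>y z. (y, z) \<in> M \<Longrightarrow> s \<le> real (card {x. (x, y) \<in> P})"
    and Q: "\<And>y z. (y, z) \<in> M \<Longrightarrow> s \<le> real (card {w. (z, w) \<in> Q})"
  shows "(real (card M) - 4 * \<rho> * n ^ 3 / (d * s)) * (d * s / 2)\<^sup>2 \<le>
    real (card {[x, y, z, w] | x y z w. (x, y) \<in> P \<and> (y, z) \<in> M \<and> (z, w) \<in> Q \<and>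
      {x, y, z} \<in> E \<and> {y, z, w} \<in> E})" (is "_ \<le> real (card ?W)")
proof -
  define X where "X p = {x. (x, fst p) \<in> P \<and> {x, fst p, snd p} \<in> E}" for p
  define Y where "Y p = {w. (snd p, w) \<in> Q \<and> {fst p, snd p, w} \<in> E}" for p
  define B1 where "B1 = {p \<in> M. real (card (X p)) \<le> d / 2 * real (card {x. (x, fst p) \<in> P})}"
  define B2 where "B2 = {p \<in> M. real (card (Y p)) \<le> d / 2 * real (card {w. (snd p, w) \<in> Q})}"
  have B1: "real (card B1) \<le> 2 * \<rho> * n ^ 3 / (d * s)"
    by (rule few_deficient_pairs[OF assms(1) _ assms(4)])
      (use assms(3) P in \<open>auto simp: B1_def X_def\<close>)
  have B2: "real (card B2) \<le> 2 * \<rho> * n ^ 3 / (d * s)"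
    by (rule few_deficient_pairs'[OF assms(2) _ assms(4)])
      (use assms(3) Q in \<open>auto simp: B2_def Y_def\<close>)
  define M' where "M' = M - (B1 \<union> B2)"
  have finM: "finite M" using finite_VV assms(3) .
  have "card M \<le> card (M' \<union> (B1 \<union> B2))"
    using finM by (intro card_mono) (auto simp: M'_def B1_def B2_def)
  also have "\<dots> \<le> card M' + (card B1 + card B2)"
    by (meson card_Un_le le_trans nat_add_left_cancel_le)
  finally have cM': "real (card M) - 4 * \<rho> * n ^ 3 / (d * s) \<le> real (card M')"
    using B1 B2 by simp
  have finX: "finite (X p)" "finite (Y p)" for p
    by (rule finite_subset[OF _ finite_V], use edgeD in \<open>auto simp: X_def Y_def\<close>)+
  have XY: "(d * s / 2)\<^sup>2 \<le> real (card (X p \<times> Y p))" if "p \<in> M'" for p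
  proof -
    have pM: "(fst p, snd p) \<in> M" using that unfolding M'_def by simp
    have "d / 2 * s \<le> d / 2 * real (card {x. (x, fst p) \<in> P})"
      using P[OF pM] d_pos by (intro mult_left_mono) auto
    moreover have "d / 2 * real (card {x. (x, fst p) \<in> P}) \<le> real (card (X p))"
      using that by (auto simp: M'_def B1_def)
    moreover have "d / 2 * s \<le> d / 2 * real (card {w. (snd p, w) \<in> Q})"
      using Q[OF pM] d_pos by (intro mult_left_mono) auto
    moreover have "d / 2 * real (card {w. (snd p, w) \<in> Q}) \<le> real (card (Y p))"
      using that by (auto simp: M'_def B2_def)
    ultimately have "d / 2 * s \<le> real (card (X p))" "d / 2 * s \<le> real (card (Y p))" by linarith+
    then have "(d / 2 * s) * (d / 2 * s) \<le> real (card (X p)) * real (card (Y p))"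
      using d_pos assms(4) by (intro mult_mono) auto
    then show ?thesis by (simp add: card_cartesian_product power2_eq_square algebra_simps)
  qed
  let ?f = "\<lambda>((y, z), (x, w)). [x, y, z, w]"
  have "?f ` (SIGMA p:M'. X p \<times> Y p) \<subseteq> ?W"
    by (auto simp: X_def Y_def M'_def)
  moreover have "finite ?W"
  proof (rule finite_subset)
    show "?W \<subseteq> {l. set l \<subseteq> V \<and> length l = 4}" using assms(1-3) by auto
    show "finite {l. set l \<subseteq> V \<and> length l = 4}" using finite_V by (rule finite_lists_length_eq)
  qed
  ultimately have "card (?f ` (SIGMA p:M'. X p \<times> Y p)) \<le> card ?W"
    by (rule card_mono[rotated])
  moreover have "card (?f ` (SIGMA p:M'. X p \<times> Y p)) = (\<Sum>p\<in>M'. card (X p \<times> Y p))"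
    using finM finX by (subst card_image) (auto simp: inj_on_def M'_def)
  ultimately have "(\<Sum>p\<in>M'. real (card (X p \<times> Y p))) \<le> real (card ?W)"
    by (simp flip: of_nat_sum)
  moreover have "real (card M') * (d * s / 2)\<^sup>2 \<le> (\<Sum>p\<in>M'. real (card (X p \<times> Y p)))"
    using XY sum_mono[of M' "\<lambda>_. (d * s / 2)\<^sup>2"] by simp
  moreover have "(real (card M) - 4 * \<rho> * n ^ 3 / (d * s)) * (d * s / 2)\<^sup>2 \<le> real (card M') * (d * s / 2)\<^sup>2"
    using cM' by (intro mult_right_mono) auto
  ultimately show ?thesis by linarith
qed

section \<open>Low pairs, normal vertices and good pairs\<close>

text \<open>Diagonal pairs are always low, since \<open>{z, x, x}\<close> has fewer than three
  elements; hence \<open>good x y\<close> entails \<open>x \<noteq> y\<close>.\<close>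

definition low :: "('a \<times> 'a) set" where
  "low = {(x, y) \<in> V \<times> V. real (card {z. {z, x, y} \<in> E}) \<le> d / 2 * n}"

text \<open>The threshold is half of that in \<open>low\<close>: of the more than
  \<open>d / 2 * n\<close> vertices that complete a good pair to an edge, at least
  \<open>d / 4 * n\<close> lead on to a pair that is not low.\<close>

definition normal :: "'a \<Rightarrow> bool" where
  "normal x \<longleftrightarrow> x \<in> V \<and> real (card {y. (x, y) \<in> low}) \<le> d / 4 * n"

definition good :: "'a \<Rightarrow> 'a \<Rightarrow> bool" where
  "good x y \<longleftrightarrow> normal x \<and> normal y \<and> (x, y) \<notin> low"

lemma low_sym: "(x, y) \<in> low \<longleftrightarrow> (y, x) \<in> low"
  unfolding low_def by (auto simp: insert_commute)

lemma good_sym: "good x y \<longleftrightarrow> good y x"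
  unfolding good_def using low_sym by blast

lemma low_subset: "low \<subseteq> V \<times> V"
  unfolding low_def by auto

lemma card_low: "real (card low) \<le> 2 * \<rho> * n\<^sup>2 / d"
proof -
  have 1: "{x. (x, y) \<in> V \<times> V} = V" if "y \<in> V" for y using that by auto
  have 2: "{x. (x, y) \<in> V \<times> V \<and> {x, y, z} \<in> E} = {x. {x, y, z} \<in> E}" for y z
    using edgeD by auto
  have "real (card low) \<le> 2 * \<rho> * n ^ 3 / (d * n)"
    by (rule few_deficient_pairs[of "V \<times> V"], unfold 2)
      (use low_subset n_pos 1 in \<open>auto simp: low_def\<close>)
  then show ?thesis using n_pos by (simp add: power2_eq_square power3_eq_cube)
qed

text \<open>Every abnormal vertex starts more than \<open>d / 4 * n\<close> low pairs, and
  \<open>card_low\<close> bounds their total.\<close>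

lemma card_abnormal: "real (card {x \<in> V. \<not> normal x}) \<le> 8 * \<rho> * n / d\<^sup>2"
proof -
  let ?A = "{x \<in> V. \<not> normal x}"
  have "(\<Sum>x\<in>?A. d / 4 * n) \<le> (\<Sum>x\<in>?A. real (card {y. (x, y) \<in> low}))"
    by (intro sum_mono) (auto simp: normal_def)
  also have "\<dots> = real (card (SIGMA x:?A. {y. (x, y) \<in> low}))"
  proof -
    have "finite {y. (x, y) \<in> low}" for x
      by (rule finite_subset[OF _ finite_V]) (use low_subset in auto)
    then show ?thesis using finite_V by simp
  qed
  also have "\<dots> \<le> real (card low)"
    using finite_VV[OF low_subset] by (intro of_nat_mono card_mono) auto
  also have "\<dots> \<le> 2 * \<rho> * n\<^sup>2 / d" by (rule card_low)
  finally have "real (card ?A) * (d\<^sup>2 * n) \<le> 8 * \<rho> * n * n"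
    using d_pos by (simp add: field_simps power2_eq_square)
  then have "real (card ?A) * d\<^sup>2 \<le> 8 * \<rho> * n"
    using n_pos by (simp add: mult.assoc[symmetric])
  then show ?thesis using d_pos by (simp add: pos_le_divide_eq)
qed

definition bad_pairs :: "('a \<times> 'a) set" where
  "bad_pairs = {(x, y) \<in> V \<times> V. \<not> good x y}"

text \<open>A bad pair is low or has an abnormal end: 18 is 2 from \<open>card_low\<close> plus
  twice the 8 from \<open>card_abnormal\<close>.\<close>

lemma card_bad_pairs: "real (card bad_pairs) \<le> 18 * \<rho> * n\<^sup>2 / d\<^sup>2"
proof -
  let ?A = "{x \<in> V. \<not> normal x}"
  have "card bad_pairs \<le> card (low \<union> (?A \<times> V \<union> V \<times> ?A))"
    using finite_V finite_VV[OF low_subset] by (intro card_mono) (auto simp: bad_pairs_def good_def)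
  also have "\<dots> \<le> card low + (card (?A \<times> V) + card (V \<times> ?A))"
    by (meson card_Un_le le_trans nat_add_left_cancel_le)
  finally have "real (card bad_pairs) \<le> real (card low) + (real (card (?A \<times> V)) + real (card (V \<times> ?A)))"
    by linarith
  then have "real (card bad_pairs) \<le> real (card low) + 2 * n * real (card ?A)"
    by (simp add: card_cartesian_product)
  also have "\<dots> \<le> 2 * \<rho> * n\<^sup>2 / d + 2 * n * (8 * \<rho> * n / d\<^sup>2)"
    using card_low card_abnormal by (intro add_mono mult_left_mono) auto
  also have "2 * \<rho> * n\<^sup>2 / d \<le> 2 * \<rho> * n\<^sup>2 / d\<^sup>2"
    using d_pos d_le_1 rho_nonneg by (intro divide_left_mono) (auto simp: power2_eq_square mult_le_one)
  finally show ?thesis by (simp add: power2_eq_square field_simps)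
qed

section \<open>Counting connectors between good pairs\<close>

definition two_steps :: "'a \<Rightarrow> 'a \<Rightarrow> ('a \<times> 'a) set" where
  "two_steps a b = {(x, y). {a, b, x} \<in> E \<and> (b, x) \<notin> low \<and> {b, x, y} \<in> E}"

lemma two_steps_subset: "two_steps a b \<subseteq> V \<times> V"
  unfolding two_steps_def using edgeD by blast

text \<open>There are at least \<open>d / 4 * n\<close> choices of \<open>x\<close>, as
  \<open>b\<close> is normal, and then at least \<open>d / 2 * n\<close> choices of
  \<open>y\<close>, as \<open>(b, x)\<close> is not low.\<close>

lemma card_two_steps:
  assumes "good a b"
  shows "d\<^sup>2 / 8 * n\<^sup>2 \<le> real (card (two_steps a b))"
proof -
  define N where "N = {x. {a, b, x} \<in> E \<and> (b, x) \<notin> low}"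
  have V: "a \<in> V" "b \<in> V" using assms unfolding good_def normal_def by auto
  have finN: "finite N" by (rule finite_subset[OF _ finite_V]) (use edgeD in \<open>auto simp: N_def\<close>)
  have finl: "finite {y. (b, y) \<in> low}"
    by (rule finite_subset[OF _ finite_V]) (use low_subset in auto)
  have "{z. {z, a, b} \<in> E} \<subseteq> N \<union> {y. (b, y) \<in> low}"
    by (auto simp: N_def insert_commute)
  then have "card {z. {z, a, b} \<in> E} \<le> card (N \<union> {y. (b, y) \<in> low})"
    using finN finl by (intro card_mono) auto
  also have "\<dots> \<le> card N + card {y. (b, y) \<in> low}" by (rule card_Un_le)
  finally have "real (card {z. {z, a, b} \<in> E}) \<le> real (card N) + real (card {y. (b, y) \<in> low})"
    by linarith
  moreover have "real (card {y. (b, y) \<in> low}) \<le> d / 4 * n" "d / 2 * n < real (card {z. {z, a, b} \<in> E})"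
    using assms V unfolding good_def normal_def low_def by auto
  ultimately have cN: "d / 4 * n \<le> real (card N)" by linarith
  have "two_steps a b = (SIGMA x:N. {y. {b, x, y} \<in> E})"
    unfolding two_steps_def N_def by auto
  moreover have "finite {y. {b, x, y} \<in> E}" for x
    by (rule finite_subset[OF _ finite_V]) (use edgeD in auto)
  ultimately have "real (card (two_steps a b)) = (\<Sum>x\<in>N. real (card {y. {b, x, y} \<in> E}))"
    using finN by simp
  moreover have "(\<Sum>x\<in>N. d / 2 * n) \<le> (\<Sum>x\<in>N. real (card {y. {b, x, y} \<in> E}))"
  proof (rule sum_mono)
    fix x assume x: "x \<in> N"
    then have "(b, x) \<in> V \<times> V" "(b, x) \<notin> low" using edgeD unfolding N_def by auto
    then have "d / 2 * n < real (card {z. {z, b, x} \<in> E})" unfolding low_def by auto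
    moreover have "{z. {z, b, x} \<in> E} = {z. {b, x, z} \<in> E}" by (auto simp: insert_commute)
    ultimately show "d / 2 * n \<le> real (card {y. {b, x, y} \<in> E})" by simp
  qed
  moreover have "d / 4 * n * (d / 2 * n) \<le> (\<Sum>x\<in>N. d / 2 * n)"
    using mult_right_mono[OF cN, of "d / 2 * n"] d_pos by simp
  ultimately show ?thesis by (simp add: power2_eq_square algebra_simps)
qed

lemma card_conv_sum_right:
  assumes "P \<subseteq> V \<times> V"
  shows "real (card P) = (\<Sum>y\<in>V. real (card {x. (x, y) \<in> P}))"
proof -
  have "P\<inverse> = (SIGMA y:V. {x. (x, y) \<in> P})" using assms by auto
  moreover have "finite {x. (x, y) \<in> P}" for y
    by (rule finite_subset[OF _ finite_V]) (use assms in auto)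
  ultimately have "real (card (P\<inverse>)) = (\<Sum>y\<in>V. real (card {x. (x, y) \<in> P}))"
    using finite_V by simp
  then show ?thesis by simp
qed

text \<open>Averaging: unpopular vertices account for at most \<open>\<gamma> / 2 * n^2\<close>
  pairs of \<open>P\<close>, so the popular ones, with at most \<open>n\<close> pairs each, must
  account for the rest.\<close>

lemma many_popular:
  assumes "P \<subseteq> V \<times> V" "0 < \<gamma>" "\<gamma> * n\<^sup>2 \<le> real (card P)"
  shows "\<gamma> / 2 * n \<le> real (card {y \<in> V. \<gamma> / 2 * n \<le> real (card {x. (x, y) \<in> P})})"
proof -
  let ?Y = "{y \<in> V. \<gamma> / 2 * n \<le> real (card {x. (x, y) \<in> P})}"
  have "real (card P) \<le> (\<Sum>y\<in>V. \<gamma> / 2 * n + (if y \<in> ?Y then n else 0))"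
    unfolding card_conv_sum_right[OF assms(1)]
  proof (rule sum_mono)
    fix y assume "y \<in> V"
    moreover have "real (card {x. (x, y) \<in> P}) \<le> n"
      by (rule card_subset_V) (use assms(1) in auto)
    moreover have "0 \<le> \<gamma> / 2 * n" using assms(2) by simp
    ultimately show "real (card {x. (x, y) \<in> P}) \<le> \<gamma> / 2 * n + (if y \<in> ?Y then n else 0)"
      by auto
  qed
  also have "\<dots> = n * (\<gamma> / 2 * n) + n * real (card ?Y)"
    using finite_V by (simp add: sum.distrib sum.If_cases Int_def)
  finally have "n * (\<gamma> / 2 * n) \<le> n * real (card ?Y)"
    using assms(3) by (simp add: power2_eq_square algebra_simps)
  then show ?thesis using n_pos by simp
qed

abbreviation quads :: "'a list set" where
  "quads \<equiv> {t. set t \<subseteq> V \<and> length t = 4}"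

lemma finite_quads: "finite quads"
  using finite_V by (rule finite_lists_length_eq)

lemma card_closed_quads: "real (card {[x, y, z, x] | x y z. x \<in> V \<and> y \<in> V \<and> z \<in> V}) \<le> n ^ 3"
proof -
  let ?T = "V \<times> V \<times> V"
  have "{[x, y, z, x] | x y z. x \<in> V \<and> y \<in> V \<and> z \<in> V} = (\<lambda>(x, y, z). [x, y, z, x]) ` ?T"
    by (auto simp: image_iff)
  moreover have "card ((\<lambda>(x, y, z). [x, y, z, x]) ` ?T) \<le> card ?T"
    using finite_V by (intro card_image_le) auto
  ultimately have "real (card {[x, y, z, x] | x y z. x \<in> V \<and> y \<in> V \<and> z \<in> V}) \<le> real (card ?T)"
    by simp
  then show ?thesis by (simp add: card_cartesian_product power3_eq_cube)
qed

text \<open>Two steps forward from \<open>(a, b)\<close> and two steps backward from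
  \<open>(c, e)\<close> reach many pairs; \<open>many_four_walks\<close> links these two families
  through middle pairs.\<close>

lemma many_connectors:
  assumes rho: "\<rho> \<le> d ^ 7 / 2 ^ 15" and \<kappa>: "4 * \<kappa> \<le> d ^ 10 / 2 ^ 19" "1 \<le> 2 * \<kappa> * n"
    and ab: "good a b" and ce: "good c e"
  shows "2 * \<kappa> * n ^ 4 \<le>
    real (card {t \<in> quads. distinct t \<and> tight_walk E (a # b # t @ [c, e])})"
    (is "_ \<le> real (card ?G)")
proof -
  define \<gamma> where "\<gamma> = d\<^sup>2 / 8"
  have \<gamma>0: "\<gamma> > 0" unfolding \<gamma>_def using d_pos by simp
  define P where "P = two_steps a b"
  define Q where "Q = (two_steps e c)\<inverse>"
  have sub: "P \<subseteq> V \<times> V" "Q \<subseteq> V \<times> V" "two_steps e c \<subseteq> V \<times> V"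
    unfolding P_def Q_def using two_steps_subset by auto
  \<comment> \<open>Every pair in \<open>Y \<times> Z\<close> is a possible middle: its first vertex
    ends many pairs of \<open>P\<close>, its second starts many pairs of \<open>Q\<close>.\<close>
  define Y where "Y = {y \<in> V. \<gamma> / 2 * n \<le> real (card {x. (x, y) \<in> P})}"
  define Z where "Z = {z \<in> V. \<gamma> / 2 * n \<le> real (card {w. (w, z) \<in> two_steps e c})}"
  have "\<gamma> / 2 * n \<le> real (card Y)" "\<gamma> / 2 * n \<le> real (card Z)"
    unfolding Y_def Z_def
    using many_popular[OF sub(1) \<gamma>0] many_popular[OF sub(3) \<gamma>0]
      card_two_steps[OF ab] card_two_steps[of e c] ce good_sym unfolding \<gamma>_def P_def by auto
  then have "\<gamma> / 2 * n * (\<gamma> / 2 * n) \<le> real (card Y) * real (card Z)"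
    using \<gamma>0 by (intro mult_mono) auto
  then have M: "\<gamma>\<^sup>2 / 4 * n\<^sup>2 \<le> real (card (Y \<times> Z))"
    by (simp add: card_cartesian_product power2_eq_square algebra_simps)
  let ?s = "\<gamma> / 2 * n"
  let ?W = "{[x, y, z, w] | x y z w. (x, y) \<in> P \<and> (y, z) \<in> Y \<times> Z \<and> (z, w) \<in> Q \<and>
      {x, y, z} \<in> E \<and> {y, z, w} \<in> E}"
  have W: "(real (card (Y \<times> Z)) - 4 * \<rho> * n ^ 3 / (d * ?s)) * (d * ?s / 2)\<^sup>2 \<le> real (card ?W)"
    by (rule many_four_walks[OF sub(1,2)])
      (use \<gamma>0 n_pos in \<open>auto simp: Y_def Z_def Q_def\<close>)
  have "4 * \<rho> * n ^ 3 / (d * ?s) = 8 * \<rho> / (d * \<gamma>) * n\<^sup>2"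
    using n_pos d_pos \<gamma>0 by (simp add: field_simps power2_eq_square power3_eq_cube)
  \<comment> \<open>The bound on \<open>\<rho>\<close> keeps the loss below half of the
    \<open>\<gamma>^2 / 4 * n^2\<close> middle pairs.\<close>
  also have "\<dots> \<le> \<gamma>\<^sup>2 / 8 * n\<^sup>2"
  proof (rule mult_right_mono)
    have "64 * \<rho> \<le> d * \<gamma> ^ 3" using rho unfolding \<gamma>_def by (simp add: eval_nat_numeral field_simps)
    then show "8 * \<rho> / (d * \<gamma>) \<le> \<gamma>\<^sup>2 / 8"
      using d_pos \<gamma>0 by (simp add: field_simps power2_eq_square power3_eq_cube)
  qed simp
  finally have "\<gamma>\<^sup>2 / 8 * n\<^sup>2 \<le> real (card (Y \<times> Z)) - 4 * \<rho> * n ^ 3 / (d * ?s)"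
    using M by linarith
  then have "\<gamma>\<^sup>2 / 8 * n\<^sup>2 * (d * ?s / 2)\<^sup>2 \<le> real (card ?W)"
    using W mult_right_mono[of _ _ "(d * ?s / 2)\<^sup>2"] by (meson order_trans zero_le_power2)
  moreover have "\<gamma>\<^sup>2 / 8 * n\<^sup>2 * (d * ?s / 2)\<^sup>2 = d ^ 10 / 2 ^ 19 * n ^ 4"
    unfolding \<gamma>_def by (simp add: eval_nat_numeral field_simps)
  moreover have "4 * \<kappa> * n ^ 4 \<le> d ^ 10 / 2 ^ 19 * n ^ 4" using \<kappa>(1) by (intro mult_right_mono) auto
  ultimately have "4 * \<kappa> * n ^ 4 \<le> real (card ?W)" by linarith
  moreover have "real (card ?W) \<le> real (card ?G) + n ^ 3"
  proof -
    let ?C = "{[x, y, z, x] | x y z. x \<in> V \<and> y \<in> V \<and> z \<in> V}"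
    \<comment> \<open>The edges \<open>{x, y, z}\<close> and \<open>{y, z, w}\<close> rule out every
      coincidence except \<open>x = w\<close>.\<close>
    have "?W \<subseteq> ?G \<union> ?C"
    proof
      fix t assume "t \<in> ?W"
      then obtain x y z w where t: "t = [x, y, z, w]" "(x, y) \<in> two_steps a b"
        "(w, z) \<in> two_steps e c" "{x, y, z} \<in> E" "{y, z, w} \<in> E"
        unfolding P_def Q_def by auto
      have e: "{a, b, x} \<in> E" "{b, x, y} \<in> E" "{z, w, c} \<in> E" "{w, c, e} \<in> E"
        using t(2,3) unfolding two_steps_def by (auto simp: insert_commute)
      have "tight_walk E (a # b # t @ [c, e])" using e t by simp
      moreover have "t \<in> quads" using edgeD[OF t(4)] edgeD[OF t(5)] t(1) by simp
      moreover have "distinct t" if "x \<noteq> w"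
        using edgeD[OF t(4)] edgeD[OF t(5)] t(1) that by simp
      moreover have "t \<in> ?C" if "x = w"
        using edgeD[OF t(4)] t(1) that by auto
      ultimately show "t \<in> ?G \<union> ?C" by blast
    qed
    moreover have "finite ?G" by (rule finite_subset[OF _ finite_quads]) auto
    moreover have "finite ?C" by (rule finite_subset[OF _ finite_quads]) auto
    ultimately have "card ?W \<le> card (?G \<union> ?C)" by (intro card_mono) auto
    also have "\<dots> \<le> card ?G + card ?C" by (rule card_Un_le)
    finally show ?thesis using card_closed_quads by linarith
  qed
  \<comment> \<open>For large \<open>n\<close> the closed quadruples cost at most half of the
    \<open>4 * \<kappa> * n ^ 4\<close> walks found.\<close>
  moreover have "n ^ 3 \<le> 2 * \<kappa> * n ^ 4"
    using mult_right_mono[OF \<kappa>(2), of "n ^ 3"] by (simp add: eval_nat_numeral algebra_simps)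
  ultimately show ?thesis by linarith
qed

section \<open>Counting absorbers in the link of a vertex\<close>

lemma card_low_degree_arcs:
  assumes "L \<subseteq> V \<times> V" "0 \<le> s"
  shows "real (card {(y, z) \<in> L. real (card {z. (y, z) \<in> L}) < s}) \<le> n * s"
proof -
  let ?B = "{(y, z) \<in> L. real (card {z. (y, z) \<in> L}) < s}"
  have fin: "finite {z. (y, z) \<in> ?B}" for y
    by (rule finite_subset[OF _ finite_V]) (use assms(1) in auto)
  have "?B = (SIGMA y:V. {z. (y, z) \<in> ?B})" using assms(1) by auto
  then have "real (card ?B) = real (card (SIGMA y:V. {z. (y, z) \<in> ?B}))" by (rule arg_cong)
  also have "\<dots> = (\<Sum>y\<in>V. real (card {z. (y, z) \<in> ?B}))"
    using fin finite_V by (subst card_SigmaI) auto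
  also have "\<dots> \<le> (\<Sum>y\<in>V. s)"
  proof (rule sum_mono)
    fix y
    show "real (card {z. (y, z) \<in> ?B}) \<le> s"
      by (cases "real (card {z. (y, z) \<in> L}) < s") (use assms(2) in auto)
  qed
  finally show ?thesis by simp
qed

text \<open>Inserting \<open>v\<close> into \<open>[x, y, z, w]\<close> creates the edges
  \<open>{x, y, v}\<close>, \<open>{y, v, z}\<close> and \<open>{v, z, w}\<close>, so an absorber is
  a path of three arcs in the link graph of \<open>v\<close> whose consecutive triples are edges.
  \<open>many_four_walks\<close> counts these.\<close>

lemma many_absorbers:
  assumes \<beta>: "0 < \<beta>" and rho: "\<rho> \<le> d * \<beta>\<^sup>2 / 64" "\<rho> \<le> d ^ 4 * \<beta> ^ 3 / 2 ^ 15"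
    and \<kappa>: "8 * \<kappa> \<le> d\<^sup>2 * \<beta> ^ 3 / 256" "1 \<le> 2 * \<kappa> * n"
    and v: "\<beta> * n\<^sup>2 \<le> real (card {(x, y). {v, x, y} \<in> E})"
  shows "2 * \<kappa> * n ^ 4 \<le>
    real (card {t \<in> quads. distinct t \<and> absorbs E v t \<and> good_ends good t})"
    (is "_ \<le> real (card ?G)")
proof -
  define L where "L = {(x, y). {v, x, y} \<in> E}"
  have L: "L \<subseteq> V \<times> V" unfolding L_def using edgeD by auto
  have Lsym: "(y, x) \<in> L \<longleftrightarrow> (x, y) \<in> L" for x y unfolding L_def by (auto simp: insert_commute)
  let ?s = "\<beta> / 4 * n"
  have s0: "0 < ?s" using \<beta> n_pos by simp
  \<comment> \<open>Only arcs whose two ends both have linear link degree can serve as middle. The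
    others lie in \<open>B\<close> or its converse, at most half of the \<open>\<beta> * n^2\<close>
    arcs.\<close>
  define M where "M = {(y, z) \<in> L. ?s \<le> real (card {z. (y, z) \<in> L}) \<and> ?s \<le> real (card {w. (z, w) \<in> L})}"
  define B where "B = {(y, z) \<in> L. real (card {z. (y, z) \<in> L}) < ?s}"
  have B: "real (card B) \<le> n * ?s"
    unfolding B_def by (rule card_low_degree_arcs[OF L less_imp_le[OF s0]])
  have "L \<subseteq> M \<union> (B \<union> B\<inverse>)" unfolding M_def B_def using Lsym by auto
  moreover have "finite M" "finite B"
    using L by (auto intro!: finite_VV simp: M_def B_def)
  ultimately have "card L \<le> card (M \<union> (B \<union> B\<inverse>))" by (intro card_mono) auto
  also have "\<dots> \<le> card M + (card B + card (B\<inverse>))"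
    by (meson card_Un_le le_trans nat_add_left_cancel_le)
  finally have "real (card L) \<le> real (card M) + 2 * real (card B)" by simp
  then have M: "\<beta> / 2 * n\<^sup>2 \<le> real (card M)"
    using B v unfolding L_def by (simp add: power2_eq_square algebra_simps)
  let ?W = "{[x, y, z, w] | x y z w. (x, y) \<in> L \<and> (y, z) \<in> M \<and> (z, w) \<in> L \<and>
      {x, y, z} \<in> E \<and> {y, z, w} \<in> E}"
  have W: "(real (card M) - 4 * \<rho> * n ^ 3 / (d * ?s)) * (d * ?s / 2)\<^sup>2 \<le> real (card ?W)"
    by (rule many_four_walks[OF L L]) (use L s0 Lsym in \<open>auto simp: M_def\<close>)
  have "4 * \<rho> * n ^ 3 / (d * ?s) = 16 * \<rho> / (d * \<beta>) * n\<^sup>2"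
    using n_pos d_pos \<beta> by (simp add: field_simps power2_eq_square power3_eq_cube)
  also have "\<dots> \<le> \<beta> / 4 * n\<^sup>2"
    using rho(1) d_pos \<beta> by (intro mult_right_mono) (auto simp: field_simps power2_eq_square)
  finally have "\<beta> / 4 * n\<^sup>2 \<le> real (card M) - 4 * \<rho> * n ^ 3 / (d * ?s)"
    using M by linarith
  then have "\<beta> / 4 * n\<^sup>2 * (d * ?s / 2)\<^sup>2 \<le> real (card ?W)"
    using W mult_right_mono[of _ _ "(d * ?s / 2)\<^sup>2"] by (meson order_trans zero_le_power2)
  moreover have "\<beta> / 4 * n\<^sup>2 * (d * ?s / 2)\<^sup>2 = d\<^sup>2 * \<beta> ^ 3 / 256 * n ^ 4"
    by (simp add: eval_nat_numeral field_simps)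
  ultimately have cW: "d\<^sup>2 * \<beta> ^ 3 / 256 * n ^ 4 \<le> real (card ?W)" by linarith
  let ?C = "{[x, y, z, x] | x y z. x \<in> V \<and> y \<in> V \<and> z \<in> V}"
  let ?B1 = "(\<lambda>((x, y), (z, w)). [x, y, z, w]) ` (bad_pairs \<times> (V \<times> V))"
  let ?B2 = "(\<lambda>((x, y), (z, w)). [x, y, z, w]) ` ((V \<times> V) \<times> bad_pairs)"
  \<comment> \<open>A walk fails to be a usable absorber only if it is closed or if its first or
    last pair is bad.\<close>
  have "?W \<subseteq> ?G \<union> (?C \<union> (?B1 \<union> ?B2))"
  proof
    fix t assume "t \<in> ?W"
    then obtain x y z w where t: "t = [x, y, z, w]" "(x, y) \<in> L" "(y, z) \<in> L" "(z, w) \<in> L"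
       "{x, y, z} \<in> E" "{y, z, w} \<in> E"
      unfolding M_def by auto
    have V: "x \<in> V" "y \<in> V" "z \<in> V" "w \<in> V" using edgeD[OF t(5)] edgeD[OF t(6)] by auto
    have "tight_walk E [x, y, v, z, w]"
      using t(2-4) unfolding L_def by (simp add: insert_commute)
    then have "absorbs E v t" unfolding absorbs_def using t by auto
    moreover have "t \<in> quads" using V t(1) by simp
    moreover have "distinct t" if "x \<noteq> w"
      using edgeD[OF t(5)] edgeD[OF t(6)] t(1) that by simp
    moreover have "t \<in> ?C" if "x = w" using V t(1) that by auto
    moreover have "t \<in> ?B1" if "\<not> good x y"
      using that V t(1) by (intro image_eqI[of _ _ "((x, y), (z, w))"]) (auto simp: bad_pairs_def)
    moreover have "t \<in> ?B2" if "\<not> good z w"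
      using that V t(1) by (intro image_eqI[of _ _ "((x, y), (z, w))"]) (auto simp: bad_pairs_def)
    moreover have "good_ends good t" if "good x y" "good z w"
      using that t(1) unfolding good_ends_def
      by (intro exI[of _ x] exI[of _ y] exI[of _ "[z, w]"] exI[of _ z] exI[of _ w] exI[of _ "[x, y]"]) auto
    ultimately show "t \<in> ?G \<union> (?C \<union> (?B1 \<union> ?B2))" by blast
  qed
  moreover have finbad: "finite bad_pairs" by (rule finite_VV) (auto simp: bad_pairs_def)
  moreover have "finite ?C" by (rule finite_subset[OF _ finite_quads]) auto
  moreover have "finite ?G" by (rule finite_subset[OF _ finite_quads]) auto
  ultimately have "card ?W \<le> card (?G \<union> (?C \<union> (?B1 \<union> ?B2)))"
    using finite_V by (intro card_mono) auto
  also have "\<dots> \<le> card ?G + (card ?C + (card ?B1 + card ?B2))"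
    by (meson card_Un_le le_trans nat_add_left_cancel_le)
  finally have "real (card ?W) \<le> real (card ?G) + (real (card ?C) + (real (card ?B1) + real (card ?B2)))"
    by linarith
  moreover have "card ?B1 \<le> card (bad_pairs \<times> (V \<times> V))" "card ?B2 \<le> card ((V \<times> V) \<times> bad_pairs)"
    by (rule card_image_le, use finbad finite_V in simp)+
  then have "real (card ?B1) \<le> real (card bad_pairs) * n\<^sup>2" "real (card ?B2) \<le> real (card bad_pairs) * n\<^sup>2"
    by (simp_all add: card_cartesian_product power2_eq_square mult.commute flip: of_nat_mult)
  moreover have "real (card bad_pairs) * n\<^sup>2 \<le> 18 * \<rho> * n\<^sup>2 / d\<^sup>2 * n\<^sup>2"
    using card_bad_pairs by (intro mult_right_mono) auto
  \<comment> \<open>Bad end pairs spoil at most half of the walks guaranteed by \<open>cW\<close>,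
    which leaves at least \<open>4 * \<kappa> * n ^ 4\<close>.\<close>
  moreover have "2 * (18 * \<rho> * n\<^sup>2 / d\<^sup>2 * n\<^sup>2) \<le> d\<^sup>2 * \<beta> ^ 3 / 256 / 2 * n ^ 4"
  proof -
    have "0 \<le> d ^ 4 * \<beta> ^ 3" using d_pos \<beta> by simp
    then have "72 * \<rho> \<le> d ^ 4 * \<beta> ^ 3 / 256" using rho(2) rho_nonneg by simp
    then have "36 * \<rho> / d\<^sup>2 \<le> d\<^sup>2 * \<beta> ^ 3 / 256 / 2"
      using d_pos by (simp add: field_simps eval_nat_numeral)
    then have "36 * \<rho> / d\<^sup>2 * n ^ 4 \<le> d\<^sup>2 * \<beta> ^ 3 / 256 / 2 * n ^ 4" by (rule mult_right_mono) simp
    then show ?thesis by (simp add: eval_nat_numeral algebra_simps)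
  qed
  moreover note cW card_closed_quads
  moreover have "8 * \<kappa> * n ^ 4 \<le> d\<^sup>2 * \<beta> ^ 3 / 256 * n ^ 4" using \<kappa>(1) by (rule mult_right_mono) simp
  moreover have "n ^ 3 \<le> 2 * \<kappa> * n ^ 4"
    using mult_right_mono[OF \<kappa>(2), of "n ^ 3"] by (simp add: eval_nat_numeral algebra_simps)
  ultimately show ?thesis by linarith
qed

end

section \<open>Long tight paths\<close>

definition shadow :: "'a set set \<Rightarrow> 'a set set" where
  "shadow E = {p. card p = 2 \<and> (\<exists>e\<in>E. p \<subseteq> e)}"

text \<open>An extremal choice replaces repeated deletion: \<open>F\<close> maximises
  \<open>card F - \<theta> * card (shadow F)\<close>. Deleting all edges through a shadow pair
  \<open>p\<close> also removes \<open>p\<close> from the shadow, so fewer than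
  \<open>\<theta>\<close> such edges would contradict maximality. As \<open>E\<close> itself has
  positive value, \<open>F\<close> is nonempty.\<close>

lemma dense_core:
  fixes E :: "'a set set" and \<theta> :: real
  assumes "finite E" "\<And>e. e \<in> E \<Longrightarrow> finite e" "0 \<le> \<theta>"
    and "\<theta> * real (card (shadow E)) < real (card E)"
  obtains F where "F \<subseteq> E" "F \<noteq> {}" "\<And>p. p \<in> shadow F \<Longrightarrow> \<theta> \<le> real (card {e \<in> F. p \<subseteq> e})"
proof -
  define g where "g F = real (card F) - \<theta> * real (card (shadow F))" for F :: "'a set set"
  have fin: "finite (g ` Pow E)" using assms(1) by simp
  then have "Max (g ` Pow E) \<in> g ` Pow E" by (rule Max_in) auto
  then obtain F where F: "F \<subseteq> E" "Max (g ` Pow E) = g F" by auto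
  have max: "g F' \<le> g F" if "F' \<subseteq> E" for F'
    using Max_ge[OF fin, of "g F'"] F(2) that by auto
  have finF: "finite F" using F(1) assms(1) finite_subset by auto
  have fin_shadow: "finite (shadow F)"
  proof (rule finite_subset)
    show "shadow F \<subseteq> Pow (\<Union>F)" unfolding shadow_def by auto
    show "finite (Pow (\<Union>F))" using F(1) finF assms(2) by auto
  qed
  have "F \<noteq> {}"
  proof
    assume "F = {}"
    then have "g F = 0" unfolding g_def shadow_def by simp
    then show False using max[of E] assms(4) unfolding g_def by simp
  qed
  moreover have "\<theta> \<le> real (card {e \<in> F. p \<subseteq> e})" if p: "p \<in> shadow F" for p
  proof -
    let ?D = "{e \<in> F. p \<subseteq> e}"
    have "card (shadow (F - ?D)) \<le> card (shadow F - {p})"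
      using fin_shadow by (intro card_mono) (auto simp: shadow_def)
    then have "card (shadow (F - ?D)) + 1 \<le> card (shadow F)"
      using p fin_shadow by (metis Suc_eq_plus1 Suc_le_mono card_Suc_Diff1)
    then have "real (card (shadow (F - ?D))) + 1 \<le> real (card (shadow F))" by linarith
    then have "\<theta> * (real (card (shadow (F - ?D))) + 1) \<le> \<theta> * real (card (shadow F))"
      using assms(3) by (rule mult_left_mono)
    moreover have "real (card (F - ?D)) = real (card F) - real (card ?D)"
      using finF by (simp add: card_Diff_subset card_mono)
    moreover have "F - ?D \<subseteq> E" using F(1) by auto
    ultimately show ?thesis
      using max[of "F - ?D"] unfolding g_def by (simp add: algebra_simps)
  qed
  ultimately show thesis using that F(1) by blast
qed

text \<open>The walk grows at its front. Its first pair lies in the shadow and so has at least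
  \<open>\<theta>\<close> extensions; while the walk is shorter than \<open>\<theta>\<close>, one of
  them is a new vertex, and the new first pair is again in the shadow.\<close>

lemma greedy_tight_walk:
  fixes \<theta> :: real
  assumes "finite F" "F \<noteq> {}" "\<And>e. e \<in> F \<Longrightarrow> card e = 3"
    and deg: "\<And>p. p \<in> shadow F \<Longrightarrow> \<theta> \<le> real (card {e \<in> F. p \<subseteq> e})"
  obtains p where "\<theta> \<le> real (length p)" "distinct p" "set p \<subseteq> \<Union>F" "tight_walk F p"
    "good_ends (\<lambda>a b. {a, b} \<in> shadow F) p"
proof -
  have "\<exists>p. (real k \<le> real (length p) \<or> \<theta> \<le> real (length p)) \<and> distinct p \<and> set p \<subseteq> \<Union>F \<and>
    tight_walk F p \<and> good_ends (\<lambda>a b. {a, b} \<in> shadow F) p" for k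
  proof (induction k)
    case 0
    obtain e where e: "e \<in> F" using assms(2) by auto
    then obtain x y z where xyz: "e = {x, y, z}" "x \<noteq> y"
      using assms(3)[OF e] unfolding card_3_iff by blast
    have "{x, y} \<in> shadow F" using e xyz by (auto simp: shadow_def)
    then have "good_ends (\<lambda>a b. {a, b} \<in> shadow F) [x, y]"
      unfolding good_ends_def
      by (intro exI[of _ x] exI[of _ y] exI[of _ "[]"] exI[of _ x] exI[of _ y] exI[of _ "[]"]) simp
    then show ?case using xyz e by (intro exI[of _ "[x, y]"]) auto
  next
    case (Suc k)
    then obtain p where p: "real k \<le> real (length p) \<or> \<theta> \<le> real (length p)" "distinct p"
      "set p \<subseteq> \<Union>F" "tight_walk F p" "good_ends (\<lambda>a b. {a, b} \<in> shadow F) p" by blast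
    show ?case
    proof (cases "\<theta> \<le> real (length p)")
      case True
      then show ?thesis using p by blast
    next
      case False
      obtain a b xs c e ys where ab: "p = a # b # xs" "p = ys @ [c, e]" "{a, b} \<in> shadow F"
          "{c, e} \<in> shadow F"
        using p(5) unfolding good_ends_def by blast
      have anb: "a \<noteq> b" using ab(1) p(2) by auto
      define Z where "Z = {z. {a, b, z} \<in> F}"
      have finZ: "finite Z"
      proof (rule finite_subset)
        show "Z \<subseteq> \<Union>F" unfolding Z_def by auto
        have "finite e" if "e \<in> F" for e using assms(3)[OF that] by (simp add: card_ge_0_finite)
        then show "finite (\<Union>F)" using assms(1) by auto
      qed
      have "{e \<in> F. {a, b} \<subseteq> e} \<subseteq> (\<lambda>z. {a, b, z}) ` Z"
      proof
        fix e assume e: "e \<in> {e \<in> F. {a, b} \<subseteq> e}"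
        then have "card (e - {a, b}) = 1"
          using assms(3)[of e] anb by (subst card_Diff_subset) auto
        then obtain z where "e - {a, b} = {z}" by (auto simp: card_1_singleton_iff)
        then have "e = {a, b, z}" using e by auto
        then show "e \<in> (\<lambda>z. {a, b, z}) ` Z" using e unfolding Z_def by auto
      qed
      then have "card {e \<in> F. {a, b} \<subseteq> e} \<le> card Z"
        using finZ by (meson card_image_le card_mono finite_imageI le_trans)
      then have "\<theta> \<le> real (card Z)" using deg[OF ab(3)] by linarith
      moreover have "card (set p) = length p" using p(2) by (rule distinct_card)
      ultimately have "card (set p) < card Z" using False by linarith
      then have "\<not> Z \<subseteq> set p" using card_mono[of "set p" Z] by auto
      then obtain z where z: "{a, b, z} \<in> F" "z \<notin> set p" unfolding Z_def by auto
      have "{z, a} \<in> shadow F"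
        using z ab(1) unfolding shadow_def by (auto intro!: bexI[OF _ z(1)])
      then have "good_ends (\<lambda>a b. {a, b} \<in> shadow F) (z # p)"
        using ab unfolding good_ends_def
        by (intro exI[of _ z] exI[of _ a] exI[of _ "b # xs"] exI[of _ c] exI[of _ e] exI[of _ "z # ys"])
          auto
      moreover have "tight_walk F (z # p)"
        using z(1) p(4) ab(1) by (simp add: insert_commute)
      ultimately show ?thesis
        using p(1-3) z False by (intro exI[of _ "z # p"]) (auto intro: bexI[OF _ z(1)])
    qed
  qed
  from this[of "nat \<lceil>\<theta>\<rceil>"] show thesis using that by (meson le_trans of_nat_ceiling order_trans)
qed

lemma tight_walk_mono: "tight_walk F p \<Longrightarrow> F \<subseteq> E \<Longrightarrow> tight_walk E p"
  unfolding tight_walk_nth by blast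

context cherry_dense
begin

lemma finite_E: "finite E"
  by (rule finite_subset[of _ "Pow V"])
    (use uniform finite_V in \<open>auto simp: uniform3_hypergraph_def\<close>)

text \<open>Density on \<open>U \<times> U\<close> yields cubically many edges inside
  \<open>U\<close>, and few of them contain a bad pair. A dense core of the rest carries a long
  greedy walk.\<close>

lemma long_good_walk:
  assumes U: "U \<subseteq> V" "\<zeta> * n \<le> real (card U)" and \<zeta>: "0 < \<zeta>" and rho: "110 * \<rho> \<le> d ^ 3 * \<zeta> ^ 3"
  obtains p where "d * \<zeta> ^ 3 / 108 * n \<le> real (length p)" "distinct p" "set p \<subseteq> U"
    "tight_walk E p" "good_ends good p"
proof -
  \<comment> \<open>All pairs inside edges of \<open>F\<close> are good, so shadow ends of a walk in
    \<open>F\<close> are good ends.\<close>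
  define F where "F = {e \<in> E. e \<subseteq> U \<and> (\<forall>x\<in>e. \<forall>y\<in>e. x \<noteq> y \<longrightarrow> good x y)}"
  have finF: "finite F" using finite_E unfolding F_def by simp
  have F3: "card e = 3" if "e \<in> F" for e
    using that uniform unfolding F_def uniform3_hypergraph_def by auto
  have finU: "finite U" using U(1) finite_V finite_subset by blast
  define T where "T = (SIGMA p:U \<times> U. {x. (x, fst p) \<in> U \<times> U \<and> {x, fst p, snd p} \<in> E})"
  have fin1: "finite {x. (x, y) \<in> U \<times> U \<and> R x}" for y and R :: "'a \<Rightarrow> bool"
    by (rule finite_subset[OF _ finU]) auto
  have "real (card T) = (\<Sum>(y, z)\<in>U \<times> U. real (card {x. (x, y) \<in> U \<times> U \<and> {x, y, z} \<in> E}))"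
    unfolding T_def using finU fin1 by (subst card_SigmaI) (auto simp: case_prod_beta)
  moreover have "(\<Sum>(y, z)\<in>U \<times> U. real (card {x. (x, y) \<in> U \<times> U})) = real (card U) ^ 3"
  proof -
    have "(\<Sum>(y, z)\<in>U \<times> U. real (card {x. (x, y) \<in> U \<times> U})) = (\<Sum>(y, z)\<in>U \<times> U. real (card U))"
      by (intro sum.cong) auto
    then show ?thesis by (simp add: card_cartesian_product power3_eq_cube)
  qed
  ultimately have T1: "d * real (card U) ^ 3 - \<rho> * n ^ 3 \<le> real (card T)"
    using dense_sum[of "U \<times> U" "U \<times> U"] U(1) by (simp add: Sigma_mono)
  \<comment> \<open>\<open>?B1\<close>, \<open>?B2\<close> and \<open>?B3\<close> cover the triples
    in which the bad pair is \<open>(y, z)\<close>, \<open>(x, y)\<close> or \<open>(x, z)\<close>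
    respectively.\<close>
  let ?B1 = "bad_pairs \<times> V"
  let ?B2 = "(\<lambda>((x, y), z). ((y, z), x)) ` ?B1"
  let ?B3 = "(\<lambda>((x, z), y). ((y, z), x)) ` ?B1"
  let ?G = "\<Union>e\<in>F. (e \<times> e) \<times> e"
  have finbad: "finite bad_pairs" by (rule finite_VV) (auto simp: bad_pairs_def)
  have "finite e" if "e \<in> F" for e using F3[OF that] by (simp add: card_ge_0_finite)
  then have finG: "finite ?G" using finF by auto
  have "T \<subseteq> ?G \<union> (?B1 \<union> (?B2 \<union> ?B3))"
  proof
    fix t assume "t \<in> T"
    then obtain x y z where t: "t = ((y, z), x)" "x \<in> U" "y \<in> U" "z \<in> U" "{x, y, z} \<in> E"
      unfolding T_def by auto
    have V: "x \<in> V" "y \<in> V" "z \<in> V" using edgeD[OF t(5)] by auto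
    have "t \<in> ?B1" if "\<not> good y z" using that V t(1) unfolding bad_pairs_def by auto
    moreover have "t \<in> ?B2" if "\<not> good x y"
      using that V t(1) by (intro image_eqI[of _ _ "((x, y), z)"]) (auto simp: bad_pairs_def)
    moreover have "t \<in> ?B3" if "\<not> good x z"
      using that V t(1) by (intro image_eqI[of _ _ "((x, z), y)"]) (auto simp: bad_pairs_def)
    moreover have "t \<in> ?G" if "good x y" "good y z" "good x z"
    proof -
      have "{x, y, z} \<in> F" unfolding F_def using that t good_sym by auto
      then show ?thesis using t(1) by (intro UN_I[of "{x, y, z}"]) auto
    qed
    ultimately show "t \<in> ?G \<union> (?B1 \<union> (?B2 \<union> ?B3))" by blast
  qed
  then have "card T \<le> card (?G \<union> (?B1 \<union> (?B2 \<union> ?B3)))"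
    using finG finbad finite_V by (intro card_mono) auto
  also have "\<dots> \<le> card ?G + (card ?B1 + (card ?B2 + card ?B3))"
    by (meson card_Un_le le_trans nat_add_left_cancel_le)
  finally have "real (card T) \<le> real (card ?G) + (real (card ?B1) + (real (card ?B2) + real (card ?B3)))"
    by linarith
  \<comment> \<open>Each edge is credited with all 27 triples over its vertices, a generous
    count.\<close>
  moreover have "card ?G \<le> (\<Sum>e\<in>F. card ((e \<times> e) \<times> e))" using finF by (rule card_UN_le)
  then have "card ?G \<le> 27 * card F" using F3 by (simp add: card_cartesian_product)
  then have "real (card ?G) \<le> 27 * real (card F)" by linarith
  moreover have "card ?B2 \<le> card ?B1" "card ?B3 \<le> card ?B1"
    by (rule card_image_le, use finbad finite_V in simp)+
  then have "real (card ?B2) \<le> real (card ?B1)" "real (card ?B3) \<le> real (card ?B1)" by auto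
  moreover have "real (card ?B1) \<le> 18 * \<rho> / d\<^sup>2 * n ^ 3"
  proof -
    have "real (card ?B1) = real (card bad_pairs) * n" by (simp add: card_cartesian_product)
    also have "\<dots> \<le> 18 * \<rho> * n\<^sup>2 / d\<^sup>2 * n" using card_bad_pairs by (rule mult_right_mono) simp
    finally show ?thesis by (simp add: power2_eq_square power3_eq_cube mult_ac)
  qed
  moreover define r where "r = 54 * \<rho> / d\<^sup>2"
  ultimately have "real (card T) \<le> 27 * real (card F) + r * n ^ 3" by simp
  \<comment> \<open>Errors take at most half of \<open>d * \<zeta> ^ 3\<close>; dividing the other
    half by 27 gives the constant 1/54 for \<open>F\<close>.\<close>
  moreover have "\<rho> + r \<le> d * \<zeta> ^ 3 / 2"
  proof -
    have "\<rho> * d\<^sup>2 \<le> \<rho> * 1"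
      using d_pos d_le_1 rho_nonneg by (intro mult_left_mono power_le_one) auto
    then have "\<rho> * d\<^sup>2 + 54 * \<rho> \<le> d ^ 3 * \<zeta> ^ 3 / 2" using rho by linarith
    then have "(\<rho> * d\<^sup>2 + 54 * \<rho>) / d\<^sup>2 \<le> (d ^ 3 * \<zeta> ^ 3 / 2) / d\<^sup>2"
      by (rule divide_right_mono) simp
    then show ?thesis
      using d_pos by (simp add: r_def add_divide_distrib power2_eq_square power3_eq_cube)
  qed
  then have "(\<rho> + r) * n ^ 3 \<le> d * \<zeta> ^ 3 / 2 * n ^ 3" by (rule mult_right_mono) simp
  moreover have "d * (\<zeta> ^ 3 * n ^ 3) \<le> d * real (card U) ^ 3"
  proof -
    have "(\<zeta> * n) ^ 3 \<le> real (card U) ^ 3" using U(2) \<zeta> by (intro power_mono) auto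
    then show ?thesis using d_pos by (simp add: power_mult_distrib)
  qed
  ultimately have F: "d * \<zeta> ^ 3 / 54 * n ^ 3 \<le> real (card F)"
    using T1 by (simp add: algebra_simps)
  \<comment> \<open>Half of the constant 1/54, so that \<open>?\<theta>\<close> times at most
    \<open>n^2\<close> shadow pairs stays strictly below \<open>card F\<close>.\<close>
  let ?\<theta> = "d * \<zeta> ^ 3 / 108 * n"
  have \<theta>0: "0 < ?\<theta>" using d_pos \<zeta> n_pos by simp
  have "shadow F \<subseteq> (\<lambda>(x, y). {x, y}) ` (V \<times> V)"
  proof
    fix p assume "p \<in> shadow F"
    then obtain x y e where "p = {x, y}" "p \<subseteq> e" "e \<in> F"
      unfolding shadow_def by (auto simp: card_2_iff)
    then show "p \<in> (\<lambda>(x, y). {x, y}) ` (V \<times> V)"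
      using U(1) unfolding F_def by (intro image_eqI[of _ _ "(x, y)"]) auto
  qed
  then have "card (shadow F) \<le> card (V \<times> V)"
    using finite_V by (meson card_image_le card_mono finite_SigmaI finite_imageI le_trans)
  then have "real (card (shadow F)) \<le> n\<^sup>2"
    using card_subset_VV[OF subset_refl] by linarith
  then have "?\<theta> * real (card (shadow F)) \<le> ?\<theta> * n\<^sup>2" using \<theta>0 by (intro mult_left_mono) auto
  also have "\<dots> = d * \<zeta> ^ 3 / 108 * n ^ 3" by (simp add: power2_eq_square power3_eq_cube)
  also have "\<dots> < d * \<zeta> ^ 3 / 54 * n ^ 3" using d_pos \<zeta> n_pos by simp
  finally have sh: "?\<theta> * real (card (shadow F)) < real (card F)" using F by linarith
  obtain F' where F': "F' \<subseteq> F" "F' \<noteq> {}" "\<And>p. p \<in> shadow F' \<Longrightarrow> ?\<theta> \<le> real (card {e \<in> F'. p \<subseteq> e})"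
    by (rule dense_core[OF finF _ less_imp_le[OF \<theta>0] sh])
      (use F3 in \<open>auto intro!: card_ge_0_finite\<close>)
  have finF': "finite F'" using F'(1) finF finite_subset by blast
  obtain p where p: "?\<theta> \<le> real (length p)" "distinct p" "set p \<subseteq> \<Union>F'" "tight_walk F' p"
      "good_ends (\<lambda>a b. {a, b} \<in> shadow F') p"
    using greedy_tight_walk[OF finF' F'(2) _ F'(3)] F'(1) F3 by blast
  have "good a b" if ab: "{a, b} \<in> shadow F'" for a b
  proof -
    obtain e where "e \<in> F'" "{a, b} \<subseteq> e" "card {a, b} = 2" using ab unfolding shadow_def by blast
    then show ?thesis using F'(1) unfolding F_def by (cases "a = b") auto
  qed
  then have "good_ends good p" using p(5) unfolding good_ends_def by blast
  moreover have "F' \<subseteq> E" using F'(1) unfolding F_def by auto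
  with p(4) have "tight_walk E p" by (rule tight_walk_mono)
  moreover have "set p \<subseteq> U" using p(3) F'(1) unfolding F_def by blast
  ultimately show thesis using that p(1,2) by blast
qed

text \<open>Long good walks are removed one after another until at most \<open>\<zeta> * n\<close>
  vertices remain. Each uses linearly many vertices, so their number is bounded independently of
  \<open>n\<close>.\<close>

lemma path_cover:
  assumes "0 < \<zeta>" "110 * \<rho> \<le> d ^ 3 * \<zeta> ^ 3" "U \<subseteq> V"
  shows "\<exists>Ps. (\<forall>p\<in>set Ps. tight_walk E p \<and> good_ends good p) \<and> distinct (concat Ps) \<and>
    set (concat Ps) \<subseteq> U \<and> real (card (U - set (concat Ps))) \<le> \<zeta> * n \<and>
    d * \<zeta> ^ 3 / 108 * n * real (length Ps) \<le> real (card U)"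
  using assms(3)
proof (induction "card U" arbitrary: U rule: less_induct)
  case less
  show ?case
  proof (cases "real (card U) \<le> \<zeta> * n")
    case True
    then show ?thesis by (intro exI[of _ "[]"]) simp
  next
    case False
    then obtain p where p: "d * \<zeta> ^ 3 / 108 * n \<le> real (length p)" "distinct p" "set p \<subseteq> U"
        "tight_walk E p" "good_ends good p"
      using long_good_walk[OF less.prems _ assms(1,2)] by (metis linorder_le_cases)
    have finU: "finite U" using less.prems finite_V finite_subset by blast
    have cp: "card (set p) = length p" using p(2) by (rule distinct_card)
    have c: "card (U - set p) = card U - length p" "length p \<le> card U"
      using p(3) finU cp by (auto simp: card_Diff_subset dest: card_mono[OF finU])
    have "p \<noteq> []" using p(5) unfolding good_ends_def by auto
    then have "card (U - set p) < card U" using c by (cases p) auto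
    then obtain Ps where Ps: "\<forall>p\<in>set Ps. tight_walk E p \<and> good_ends good p" "distinct (concat Ps)"
      "set (concat Ps) \<subseteq> U - set p" "real (card (U - set p - set (concat Ps))) \<le> \<zeta> * n"
      "d * \<zeta> ^ 3 / 108 * n * real (length Ps) \<le> real (card (U - set p))"
      using less.hyps[of "U - set p"] less.prems by auto
    have "distinct (concat (p # Ps))" using p(2) Ps(2,3) by (auto simp del: set_concat)
    moreover have "U - set (concat (p # Ps)) = U - set p - set (concat Ps)" by auto
    moreover have "d * \<zeta> ^ 3 / 108 * n * real (length (p # Ps)) \<le> real (card U)"
      using Ps(5) p(1) c by (simp add: algebra_simps)
    ultimately show ?thesis
      using p Ps by (intro exI[of _ "p # Ps"]) auto
  qed
qed

end

section \<open>Assembling the cycle\<close>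

text \<open>If every member met \<open>X\<close>, disjointness would give an injection from the
  family into \<open>X\<close>.\<close>

lemma disjoint_member_avoids:
  assumes "finite X" "card X < card \<T>" "\<And>s t. s \<in> \<T> \<Longrightarrow> t \<in> \<T> \<Longrightarrow> s \<noteq> t \<Longrightarrow> set s \<inter> set t = {}"
  obtains t where "t \<in> \<T>" "set t \<inter> X = {}"
proof (rule ccontr)
  assume "\<not> thesis"
  then have "\<forall>t\<in>\<T>. \<exists>x. x \<in> set t \<inter> X" using that by blast
  then obtain f where f: "\<And>t. t \<in> \<T> \<Longrightarrow> f t \<in> set t \<inter> X" by metis
  then have "inj_on f \<T>" using assms(3) by (intro inj_onI) (metis IntD1 disjoint_iff)
  moreover have "f ` \<T> \<subseteq> X" using f by auto
  ultimately show False using assms(1,2) by (metis card_inj_on_le leD)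
qed

text \<open>Each term is at most the whole potential, so a potential below
  \<open>(1 / 2) ^ k\<close> forces \<open>k\<close> hits for every index.\<close>

lemma hits_bound:
  assumes "finite I" "i \<in> I" "(\<Sum>i\<in>I. (1 / 2 :: real) ^ card (\<T> \<inter> S i)) \<le> (1 / 2) ^ k"
  shows "k \<le> card (\<T> \<inter> S i)"
proof -
  have "(1 / 2 :: real) ^ card (\<T> \<inter> S i) \<le> (\<Sum>i\<in>I. (1 / 2) ^ card (\<T> \<inter> S i))"
    using assms(1,2) by (intro member_le_sum) auto
  also note assms(3)
  finally show ?thesis by simp
qed

lemma card_UN_quads:
  assumes "finite \<T>" "card \<T> \<le> m" "\<And>t. t \<in> \<T> \<Longrightarrow> length t = 4"
  shows "card (\<Union>t\<in>\<T>. set t) \<le> 4 * m"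
proof -
  have "card (\<Union>t\<in>\<T>. set t) \<le> (\<Sum>t\<in>\<T>. card (set t))" using assms(1) by (rule card_UN_le)
  also have "\<dots> \<le> (\<Sum>t\<in>\<T>. 4)"
    by (rule sum_mono) (use assms(3) in \<open>auto intro: order_trans[OF card_length]\<close>)
  finally show ?thesis using assms(2) by simp
qed

context cherry_dense
begin

text \<open>At most half of the connectors meet the few vertices that lie in \<open>X\<close> or
  outside \<open>R\<close>.\<close>

lemma supplies_if_many_connectors:
  assumes conn: "\<And>a b c e. good a b \<Longrightarrow> good c e \<Longrightarrow> 2 * \<kappa> * n ^ 4 \<le>
      real (card {t \<in> quads. distinct t \<and> tight_walk E (a # b # t @ [c, e])})"
    and "R \<subseteq> V" "0 < \<kappa>" "4 * (real (card (V - R)) + real k) \<le> \<kappa> * n"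
  shows "supplies E good R k"
  unfolding supplies_def
proof (intro allI impI, elim conjE)
  fix a b c e and X :: "'a set"
  assume g: "good a b" "good c e" and X: "finite X" "card X \<le> k"
  let ?C = "{t \<in> quads. distinct t \<and> tight_walk E (a # b # t @ [c, e])}"
  let ?F = "V - R \<union> X"
  let ?M = "{l. set l \<subseteq> V \<and> length l = 4 \<and> set l \<inter> ?F \<noteq> {}}"
  have finF: "finite ?F" using finite_V X(1) by simp
  have "card ?F \<le> card (V - R) + card X" by (rule card_Un_le)
  then have "real (card ?F) \<le> real (card (V - R)) + real k" using X(2) by linarith
  then have "4 * real (card ?F) / n \<le> \<kappa>" using assms(4) n_pos by (simp add: divide_le_eq)
  then have "4 * real (card ?F) / n * n ^ 4 \<le> \<kappa> * n ^ 4" by (rule mult_right_mono) simp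
  then have "real (card ?M) \<le> \<kappa> * n ^ 4"
    using few_lists_meet[OF finite_V V_nonempty finF, of 4] by simp
  moreover have "0 < \<kappa> * n ^ 4" using assms(3) n_pos by simp
  ultimately have "card ?M < card ?C" using conn[OF g] by linarith
  moreover have "finite ?M" by (rule finite_subset[OF _ finite_quads]) auto
  ultimately have "\<not> ?C \<subseteq> ?M" using card_mono[of ?M ?C] by linarith
  then obtain t where "t \<in> ?C" "t \<notin> ?M" by blast
  then show "\<exists>t. length t = 4 \<and> distinct t \<and> set t \<subseteq> R - X \<and> tight_walk E (a # b # t @ [c, e])"
    by (intro exI[of _ t]) auto
qed

text \<open>Here \<open>m\<close> and \<open>r\<close> bound the numbers of absorbers and of
  reservoir connectors, \<open>k\<close> is how many vertices can be absorbed, and \<open>K\<close>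
  bounds the number of covering paths. Isolating these inequalities separates the construction from
  the choice of constants.\<close>

lemma Hamilton_cycle_from_parameters:
  assumes conn: "\<And>a b c e. good a b \<Longrightarrow> good c e \<Longrightarrow> 2 * \<kappa> * n ^ 4 \<le>
      real (card {t \<in> quads. distinct t \<and> tight_walk E (a # b # t @ [c, e])})"
    and abs: "\<And>v. v \<in> V \<Longrightarrow> 2 * \<kappa> * n ^ 4 \<le>
      real (card {t \<in> quads. distinct t \<and> absorbs E v t \<and> good_ends good t})"
    and \<kappa>: "0 < \<kappa>"
    and \<zeta>: "0 < \<zeta>" "110 * \<rho> \<le> d ^ 3 * \<zeta> ^ 3"
    and sizes: "4 * (8 * real m + 4 * real r) \<le> \<kappa> * n"
    and hits: "n * (1 - \<kappa> / 2) ^ m \<le> (1 / 2) ^ k" "n ^ 4 * (1 - \<kappa> / 2) ^ r \<le> (1 / 2) ^ (4 * K + 5)"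
    and leftover: "\<zeta> * n + 4 * real r \<le> real k"
    and K: "108 / (d * \<zeta> ^ 3) \<le> real K"
  shows "\<exists>vs. tight_Hamilton_cycle V E vs"
proof -
  define S where "S v = {t \<in> quads. distinct t \<and> absorbs E v t \<and> good_ends good t}" for v
  have S: "S v \<subseteq> quads" "v \<in> V \<Longrightarrow> 2 * \<kappa> * n ^ 4 \<le> real (card (S v))" for v
    using abs[of v] unfolding S_def by auto
  have sizes1: "real 4 * (real (card ({} :: 'a set)) + real 4 * real m) \<le> \<kappa> * n"
    using sizes by simp
  \<comment> \<open>There are only \<open>n ^ 4\<close> quadruples, so
    \<open>2 * \<kappa> \<le> 1\<close>. The sign is needed to replace \<open>card I\<close> by
    \<open>n ^ 4\<close> below.\<close>
  have nonneg: "0 \<le> 1 - \<kappa> / 2"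
  proof -
    obtain v where v: "v \<in> V" using V_nonempty by auto
    have "card (S v) \<le> card quads" unfolding S_def using finite_quads by (intro card_mono) auto
    also have "\<dots> = card V ^ 4" using finite_V by (rule card_lists_length_eq)
    finally have "real (card (S v)) \<le> n ^ 4" by (simp flip: of_nat_power)
    then have "2 * \<kappa> * n ^ 4 \<le> 1 * n ^ 4" using abs[OF v] unfolding S_def by linarith
    then have "2 * \<kappa> \<le> 1" using n_pos by (simp only: mult_le_cancel_right_pos zero_less_power)
    then show ?thesis by simp
  qed
  obtain \<T> where T: "finite \<T>" "card \<T> \<le> m" "\<T> \<subseteq> (\<Union>v\<in>V. S v)"
    "\<And>s t. s \<in> \<T> \<Longrightarrow> t \<in> \<T> \<Longrightarrow> s \<noteq> t \<Longrightarrow> set s \<inter> set t = {}"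
    "(\<Sum>v\<in>V. (1 / 2) ^ card (\<T> \<inter> S v)) \<le> n * (1 - \<kappa> / 2) ^ m"
    by (rule greedy_selection[where S = S and r = 4 and m = m,
        OF finite_V V_nonempty finite_V finite.emptyI \<kappa> zero_less_numeral S sizes1]) (assumption, rule that)
  have T_hits: "k \<le> card (\<T> \<inter> S v)" if "v \<in> V" for v
    by (rule hits_bound[OF finite_V that order_trans[OF T(5) hits(1)]])
  have TS: "length t = 4" "set t \<subseteq> V" "distinct t" "tight_walk E t" "good_ends good t"
    if "t \<in> \<T>" for t
    using that T(3) unfolding S_def absorbs_def by auto
  have "k > 0"
  proof -
    have "0 < \<zeta> * n" using \<zeta>(1) n_pos by simp
    then show ?thesis using leftover by (cases k) auto
  qed
  then have T_ne: "\<T> \<noteq> {}" using T_hits V_nonempty by fastforce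
  define A0 where "A0 = (\<Union>t\<in>\<T>. set t)"
  have A0V: "A0 \<subseteq> V" unfolding A0_def using TS(2) by blast
  have cA0: "card A0 \<le> 4 * m" unfolding A0_def using T(1,2) TS(1) by (rule card_UN_quads)
  \<comment> \<open>The absorbers are joined by connectors outside \<open>A0\<close>, with a budget
    of four vertices for each.\<close>
  have supA: "supplies E good (V - A0) (4 * m)"
  proof (rule supplies_if_many_connectors[OF conn _ \<kappa>])
    have "V - (V - A0) = A0" using A0V by auto
    then show "4 * (real (card (V - (V - A0))) + real (4 * m)) \<le> \<kappa> * n"
      using cA0 sizes by simp
  qed auto
  obtain Ts where Ts: "set Ts = \<T>" "distinct Ts"
    using finite_distinct_list[OF T(1)] by blast
  have setTs: "set (concat Ts) = A0" unfolding A0_def using Ts(1) by auto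
  have "\<exists>As. set Ts \<subseteq> set As \<and> distinct (concat As) \<and> tight_walk E (concat As) \<and>
    good_ends good (concat As) \<and> set (concat As) \<subseteq> set (concat Ts) \<union> (V - A0) \<and>
    card (set (concat As) \<inter> (V - A0)) \<le> 4 * length Ts"
  proof (rule join_blocks[OF _ _ _ _ supA])
    show "distinct (concat Ts)"
      using Ts T(4) TS(3) by (intro distinct_concat) auto
    show "4 * length Ts \<le> 4 * m" using T(2) Ts distinct_card[OF Ts(2)] by simp
  qed (use Ts(1) T_ne TS setTs in auto)
  then obtain As where As: "\<T> \<subseteq> set As" "distinct (concat As)" "tight_walk E (concat As)"
    "good_ends good (concat As)" "set (concat As) \<subseteq> set (concat Ts) \<union> (V - A0)"
    "card (set (concat As) \<inter> (V - A0)) \<le> 4 * length Ts"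
    using Ts(1) by blast
  define A where "A = set (concat As)"
  have AV: "A \<subseteq> V" using As(5) A0V setTs unfolding A_def by blast
  have cA: "card A \<le> 8 * m"
  proof -
    have "A \<subseteq> A0 \<union> (A \<inter> (V - A0))" using AV by auto
    then have "card A \<le> card (A0 \<union> (A \<inter> (V - A0)))"
      using AV A0V finite_V by (intro card_mono) (auto intro: finite_subset)
    also have "\<dots> \<le> card A0 + card (A \<inter> (V - A0))" by (rule card_Un_le)
    finally show ?thesis
      using cA0 As(6) T(2) Ts distinct_card[OF Ts(2)] unfolding A_def by simp
  qed
  \<comment> \<open>The reservoir has to serve every two good pairs, so these are the indices of the
    second greedy selection, which also avoids \<open>A\<close>.\<close>
  define I where "I = {(a, b, c, e). good a b \<and> good c e}"
  have IV: "I \<subseteq> V \<times> V \<times> V \<times> V" unfolding I_def good_def normal_def by auto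
  have finI: "finite I" by (rule finite_subset[OF IV]) (use finite_V in auto)
  have cI: "real (card I) \<le> n ^ 4"
  proof -
    have "card I \<le> card (V \<times> V \<times> V \<times> V)" using IV finite_V by (intro card_mono) auto
    then have "real (card I) \<le> real (card (V \<times> V \<times> V \<times> V))" by simp
    then show ?thesis by (simp add: card_cartesian_product eval_nat_numeral)
  qed
  define C where "C = (\<lambda>(a, b, c, e). {t \<in> quads. distinct t \<and> tight_walk E (a # b # t @ [c, e])})"
  have C: "C i \<subseteq> quads" "i \<in> I \<Longrightarrow> 2 * \<kappa> * n ^ 4 \<le> real (card (C i))" for i
    using conn by (cases i, force simp: C_def, cases i, simp add: C_def I_def)
  have sizes2: "real 4 * (real (card A) + real 4 * real r) \<le> \<kappa> * n"
    using sizes cA by simp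
  have finA: "finite A" unfolding A_def by simp
  obtain \<S> where R: "finite \<S>" "card \<S> \<le> r" "\<S> \<subseteq> (\<Union>i\<in>I. C i)"
    "\<And>s t. s \<in> \<S> \<Longrightarrow> t \<in> \<S> \<Longrightarrow> s \<noteq> t \<Longrightarrow> set s \<inter> set t = {}" "\<And>t. t \<in> \<S> \<Longrightarrow> set t \<inter> A = {}"
    "(\<Sum>i\<in>I. (1 / 2) ^ card (\<S> \<inter> C i)) \<le> real (card I) * (1 - \<kappa> / 2) ^ r"
    by (rule greedy_selection[where S = C and r = 4 and m = r,
        OF finite_V V_nonempty finI finA \<kappa> zero_less_numeral C sizes2]) (assumption, rule that)
  have le: "real (card I) * (1 - \<kappa> / 2) ^ r \<le> n ^ 4 * (1 - \<kappa> / 2) ^ r"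
    using cI nonneg by (intro mult_right_mono) auto
  have S_hits: "4 * K + 5 \<le> card (\<S> \<inter> C i)" if "i \<in> I" for i
    by (rule hits_bound[OF finI that order_trans[OF R(6) order_trans[OF le hits(2)]]])
  have SS: "length t = 4" "set t \<subseteq> V" if "t \<in> \<S>" for t
    using that R(3) unfolding C_def by auto
  define R where "R = (\<Union>t\<in>\<S>. set t)"
  have RV: "R \<subseteq> V" and RA: "R \<inter> A = {}" unfolding R_def using SS(2) R(5) by blast+
  have cR: "card R \<le> 4 * r" unfolding R_def using R(1,2) SS(1) by (rule card_UN_quads)
  have supR: "supplies E good R (4 * K + 4)"
    unfolding supplies_def
  proof (intro allI impI, elim conjE)
    fix a b c e and X :: "'a set"
    assume g: "good a b" "good c e" and X: "finite X" "card X \<le> 4 * K + 4"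
    \<comment> \<open>A set of \<open>4 * K + 4\<close> vertices cannot meet all of
      \<open>4 * K + 5\<close> disjoint connectors.\<close>
    have "card X < card (\<S> \<inter> C (a, b, c, e))"
      using S_hits[of "(a, b, c, e)"] g X(2) unfolding I_def by simp
    then obtain t where t: "t \<in> \<S> \<inter> C (a, b, c, e)" "set t \<inter> X = {}"
      using disjoint_member_avoids[OF X(1)] R(4) by (metis IntD1)
    have "set t \<subseteq> R" using t(1) unfolding R_def by blast
    then show "\<exists>t. length t = 4 \<and> distinct t \<and> set t \<subseteq> R - X \<and> tight_walk E (a # b # t @ [c, e])"
      using t unfolding C_def by (intro exI[of _ t]) auto
  qed
  define U where "U = V - A - R"
  have UV: "U \<subseteq> V" unfolding U_def by auto
  obtain Ps where Ps: "\<forall>p\<in>set Ps. tight_walk E p \<and> good_ends good p" "distinct (concat Ps)"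
    "set (concat Ps) \<subseteq> U" "real (card (U - set (concat Ps))) \<le> \<zeta> * n"
    "d * \<zeta> ^ 3 / 108 * n * real (length Ps) \<le> real (card U)"
    using path_cover[OF \<zeta> UV] by blast
  have lenPs: "length Ps \<le> K"
  proof -
    have "d * \<zeta> ^ 3 / 108 * real (length Ps) * n \<le> 1 * n"
      using Ps(5) card_subset_V[OF UV] by (simp add: mult_ac)
    then have "d * \<zeta> ^ 3 / 108 * real (length Ps) \<le> 1"
      using n_pos by (simp only: mult_le_cancel_right_pos)
    then have "real (length Ps) \<le> 108 / (d * \<zeta> ^ 3)" using d_pos \<zeta>(1) by (simp add: field_simps)
    then show ?thesis using K by linarith
  qed
  \<comment> \<open>At most \<open>K + 1\<close> blocks are joined, so at most
    \<open>4 * K + 4\<close> reservoir vertices are spent before the cycle is closed.\<close>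
  let ?Bs = "concat As # Ps"
  have "\<exists>Ds. set ?Bs \<subseteq> set Ds \<and> distinct (concat Ds) \<and> tight_walk E (concat Ds) \<and>
    good_ends good (concat Ds) \<and> set (concat Ds) \<subseteq> set (concat ?Bs) \<union> R \<and>
    card (set (concat Ds) \<inter> R) \<le> 4 * length ?Bs"
  proof (rule join_blocks[OF _ _ _ _ supR])
    have "set (concat As) \<inter> set (concat Ps) = {}" using Ps(3) unfolding U_def A_def by blast
    then show "distinct (concat ?Bs)" using As(2) Ps(2) by (simp del: set_concat)
    have "set (concat ?Bs) \<subseteq> A \<union> U" using Ps(3) unfolding A_def by auto
    then show "set (concat ?Bs) \<inter> R = {}" using RA unfolding U_def by blast
    show "4 * length ?Bs \<le> 4 * K + 4" using lenPs by simp
  qed (use As(3,4) Ps(1) in auto)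
  then obtain Ds where Ds: "set ?Bs \<subseteq> set Ds" "distinct (concat Ds)" "tight_walk E (concat Ds)"
    "good_ends good (concat Ds)" "set (concat Ds) \<subseteq> set (concat ?Bs) \<union> R"
    "card (set (concat Ds) \<inter> R) \<le> 4 * length ?Bs" by blast
  have "card (set (concat Ds) \<inter> R) \<le> 4 * K + 4" using Ds(6) lenPs by simp
  then obtain t where t: "length t = 4" "distinct (t @ concat Ds)" "set t \<subseteq> R"
      "tight_walk E (t @ concat Ds @ take 2 t)"
    using close_cycle[OF supR Ds(4,3,2)] by metis
  \<comment> \<open>What is missing from the cycle: vertices left by the path cover and the unspent
    part of the reservoir.\<close>
  define L where "L = V - set (t @ concat Ds)"
  have "set (concat ?Bs) \<subseteq> set (concat Ds)"
    unfolding set_concat using Ds(1) by (rule UN_mono) simp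
  then have "A \<union> set (concat Ps) \<subseteq> set (concat Ds)" unfolding A_def by simp
  then have "L \<subseteq> (U - set (concat Ps)) \<union> R" unfolding L_def U_def by auto
  then have "card L \<le> card ((U - set (concat Ps)) \<union> R)"
    using finite_V RV by (intro card_mono) (auto simp: U_def intro: finite_subset)
  also have "\<dots> \<le> card (U - set (concat Ps)) + card R" by (rule card_Un_le)
  finally have "real (card L) \<le> \<zeta> * n + 4 * real r" using Ps(4) cR by linarith
  then have cL: "card L \<le> k" using leftover by linarith
  have finL: "finite L" unfolding L_def using finite_V by simp
  \<comment> \<open>The absorbing path is still a single block, so absorption changes only this
    segment of the cycle.\<close>
  obtain D1 D2 where D: "Ds = D1 @ concat As # D2"
    using Ds(1) by (metis list.set_intros(1) split_list subsetD)
  have "\<exists>xs. mset xs = mset (concat As) + mset_set L \<and>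
      tight_walk E ((t @ concat D1) @ xs @ (concat D2 @ take 2 t))"
  proof (rule absorb_many[OF finL T(1) As(1)])
    fix v assume "v \<in> L"
    then have "v \<in> V" unfolding L_def by simp
    have "\<T> \<inter> S v \<subseteq> {t \<in> \<T>. absorbs E v t}" unfolding S_def by auto
    then have "card (\<T> \<inter> S v) \<le> card {t \<in> \<T>. absorbs E v t}"
      using T(1) by (intro card_mono) auto
    then show "card L \<le> card {t \<in> \<T>. absorbs E v t}"
      using T_hits[OF \<open>v \<in> V\<close>] cL by linarith
  qed (use t(4) D in simp)
  then obtain xs where xs: "mset xs = mset (concat As) + mset_set L"
    "tight_walk E ((t @ concat D1) @ xs @ (concat D2 @ take 2 t))" by blast
  define vs where "vs = t @ concat D1 @ xs @ concat D2"
  have J: "set (t @ concat Ds) \<subseteq> V"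
    using t(3) RV Ds(5) AV Ps(3) UV unfolding A_def by (auto simp del: set_concat) (auto, blast+)
  \<comment> \<open>Comparing multisets with \<open>mset_set V\<close> settles distinctness and
    spanning at once.\<close>
  have "mset vs = mset (t @ concat Ds) + mset_set L" unfolding vs_def D using xs(1) by simp
  also have "mset (t @ concat Ds) = mset_set (set (t @ concat Ds))"
    using t(2) by (rule mset_set_set[symmetric])
  also have "\<dots> + mset_set L = mset_set (set (t @ concat Ds) \<union> L)"
    using finL by (intro mset_set_Union[symmetric]) (auto simp: L_def)
  also have "set (t @ concat Ds) \<union> L = V" using J unfolding L_def by blast
  finally have mvs: "mset vs = mset_set V" .
  obtain ws where ws: "set ws = V" "distinct ws" using finite_distinct_list[OF finite_V] by blast
  then have "mset vs = mset ws" using mvs mset_set_set[of ws] by simp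
  then have "distinct vs" "set vs = V"
    using ws mset_eq_imp_distinct_iff mset_eq_setD by blast+
  moreover have "tight_walk E (vs @ take 2 vs)"
    using xs(2) t(1) unfolding vs_def by simp
  moreover have "3 \<le> length vs" using t(1) unfolding vs_def by simp
  ultimately show ?thesis using tight_Hamilton_cycleI by blast
qed

end

section \<open>Asymptotics and the choice of constants\<close>

text \<open>With \<open>c\<close> half the decay rate, the power of \<open>q\<close> is of order
  \<open>exp (- 2 * c * N)\<close>. One factor \<open>exp (c * N)\<close> pays for
  \<open>N ^ 4\<close>; the remaining decay, rewritten in base 2, determines
  \<open>\<tau>\<close>.\<close>

lemma power_times_exponential_small:
  fixes q \<mu> :: real
  assumes "0 < q" "q < 1" "0 < \<mu>"
  obtains \<tau> where "0 < \<tau>"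
    "\<forall>\<^sub>F N in sequentially. real N ^ 4 * q ^ nat \<lfloor>\<mu> * real N\<rfloor> \<le> (1 / 2) ^ nat \<lfloor>\<tau> * real N\<rfloor>"
proof -
  define c where "c = - \<mu> * ln q / 2"
  have lnq: "ln q < 0" using assms by simp
  have c: "0 < c" unfolding c_def using lnq assms(3) by (simp add: mult_pos_neg)
  define \<tau> where "\<tau> = c / ln 2"
  have "filterlim (\<lambda>N. c * real N) at_top sequentially"
    using c by (intro filterlim_tendsto_pos_mult_at_top[OF tendsto_const] filterlim_real_sequentially)
  from filterlim_compose[OF tendsto_power_div_exp_0[of 4] this]
  have "(\<lambda>N. (c * real N) ^ 4 / exp (c * real N)) \<longlonglongrightarrow> 0" .
  \<comment> \<open>The extra factor \<open>q\<close> compensates for rounding the exponent down,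
    which costs at most \<open>1 / q\<close>.\<close>
  then have "\<forall>\<^sub>F N in sequentially. (c * real N) ^ 4 / exp (c * real N) < c ^ 4 * q"
    by (rule order_tendstoD(2)) (use c assms in simp)
  then have "\<forall>\<^sub>F N in sequentially. real N ^ 4 * q ^ nat \<lfloor>\<mu> * real N\<rfloor> \<le> (1 / 2) ^ nat \<lfloor>\<tau> * real N\<rfloor>"
  proof eventually_elim
    case (elim N)
    have "real N ^ 4 * c ^ 4 < (q * exp (c * real N)) * c ^ 4"
      using elim by (simp add: power_mult_distrib divide_less_eq mult_ac)
    then have N4: "real N ^ 4 \<le> q * exp (c * real N)" using c by (simp add: mult_less_cancel_right)
    let ?k = "nat \<lfloor>\<mu> * real N\<rfloor>" and ?j = "nat \<lfloor>\<tau> * real N\<rfloor>"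
    have "\<mu> * real N - 1 \<le> real ?k" by linarith
    then have "real ?k * ln q \<le> (\<mu> * real N - 1) * ln q"
      using lnq by (simp add: mult_right_mono_neg)
    also have "\<dots> = - 2 * (c * real N) - ln q" unfolding c_def by (simp add: algebra_simps)
    finally have "exp (real ?k * ln q) \<le> exp (- 2 * (c * real N) - ln q)" by simp
    then have qk: "q ^ ?k \<le> exp (- 2 * (c * real N)) / q"
      using assms(1) by (simp add: exp_of_nat_mult exp_diff)
    have "0 \<le> \<tau> * real N" unfolding \<tau>_def using c by simp
    then have "real ?j \<le> \<tau> * real N" by linarith
    then have "real ?j * ln 2 \<le> c * real N"
      using mult_right_mono[of "real ?j" "\<tau> * real N" "ln 2"] unfolding \<tau>_def by simp
    then have "exp (- (c * real N)) \<le> exp (- (real ?j * ln 2))" by simp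
    also have "\<dots> = (1 / 2) ^ ?j" by (simp add: exp_minus exp_of_nat_mult power_one_over inverse_eq_divide)
    finally have j: "exp (- (c * real N)) \<le> (1 / 2) ^ ?j" .
    have "real N ^ 4 * q ^ ?k \<le> (q * exp (c * real N)) * (exp (- 2 * (c * real N)) / q)"
      using N4 qk assms(1) by (intro mult_mono) auto
    also have "\<dots> = exp (- (c * real N))" using assms(1) by (simp flip: exp_add)
    finally show ?case using j by linarith
  qed
  moreover have "0 < \<tau>" unfolding \<tau>_def using c by simp
  ultimately show thesis using that by blast
qed

text \<open>Every edge through \<open>v\<close> yields at least one ordered link pair, and
  \<open>n choose 2\<close> is at least \<open>n^2 / 4\<close> once
  \<open>n \<ge> 2\<close>.\<close>

lemma card_link_ge:
  assumes "uniform3_hypergraph V E" "v \<in> V" "2 \<le> card V" "0 \<le> \<alpha>"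
    and "\<alpha> * real (card V choose 2) \<le> real (min_vertex_degree V E)"
  shows "\<alpha> / 4 * (real (card V))\<^sup>2 \<le> real (card {(x, y). {v, x, y} \<in> E})"
proof -
  have fin: "finite V" using assms(1) unfolding uniform3_hypergraph_def by simp
  let ?L = "{(x, y). {v, x, y} \<in> E}"
  have "?L \<subseteq> V \<times> V" using assms(1) unfolding uniform3_hypergraph_def by auto
  then have finL: "finite ?L" using fin by (simp add: finite_subset)
  have "{e \<in> E. v \<in> e} \<subseteq> (\<lambda>(x, y). {v, x, y}) ` ?L"
  proof
    fix e assume e: "e \<in> {e \<in> E. v \<in> e}"
    then have "card e = 3" using assms(1) unfolding uniform3_hypergraph_def by auto
    then have "card (e - {v}) = 2" using e by (simp add: card_Diff_singleton)
    then obtain x y where "e - {v} = {x, y}" by (auto simp: card_2_iff)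
    then have "e = {v, x, y}" using e by auto
    then show "e \<in> (\<lambda>(x, y). {v, x, y}) ` ?L" using e by (intro image_eqI[of _ _ "(x, y)"]) auto
  qed
  then have "vertex_degree E v \<le> card ?L"
    unfolding vertex_degree_def using finL by (meson card_image_le card_mono finite_imageI le_trans)
  moreover have "min_vertex_degree V E \<le> vertex_degree E v"
    unfolding min_vertex_degree_def using fin assms(2) by (intro Min_le) auto
  ultimately have "\<alpha> * real (card V choose 2) \<le> real (card ?L)" using assms(5) by linarith
  moreover have "real (card V) * real (card V) / 4 \<le> real (card V choose 2)"
  proof -
    have "real (card V choose 2) = real (card V) * (real (card V) - 1) / 2"
      using assms(3) by (simp add: choose_two real_of_nat_div)
    moreover have "real (card V) * 2 \<le> real (card V) * real (card V)"
      using assms(3) by (intro mult_left_mono) auto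
    ultimately show ?thesis by (simp add: algebra_simps)
  qed
  then have "\<alpha> * (real (card V) * real (card V) / 4) \<le> \<alpha> * real (card V choose 2)"
    using assms(4) by (rule mult_left_mono)
  ultimately show ?thesis by (simp add: power2_eq_square)
qed

lemma pair_pair_dense_mono:
  assumes "pair_pair_dense \<rho> d V E" "d' \<le> d"
  shows "pair_pair_dense \<rho> d' V E"
  unfolding pair_pair_dense_def
proof (intro allI impI)
  fix P Q :: "('a \<times> 'a) set"
  assume PQ: "P \<subseteq> V \<times> V \<and> Q \<subseteq> V \<times> V"
  let ?c = "real (card {((x, y), (y, z)) | x y z. (x, y) \<in> P \<and> (y, z) \<in> Q})"
  have "d' * ?c \<le> d * ?c" using assms(2) by (rule mult_right_mono) simp
  moreover note assms(1)[unfolded pair_pair_dense_def, rule_format, OF PQ]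
  ultimately show "d' * ?c - \<rho> * real (card V) ^ 3
      \<le> real (card {((x, y), (y, z)) | x y z. (x, y) \<in> P \<and> (y, z) \<in> Q \<and> {x, y, z} \<in> E})"
    by linarith
qed

theorem theorem1p4:
  fixes d \<alpha> :: real
  assumes "d > 0" and "\<alpha> > 0"
  shows "\<exists>\<rho>>0. \<exists>n0::nat. \<forall>(V :: 'a set) E n.
           uniform3_hypergraph V E \<and> card V = n \<and> n \<ge> n0 \<and>
           pair_pair_dense \<rho> d V E \<and>
           real (min_vertex_degree V E) \<ge> \<alpha> * real (n choose 2)
           \<longrightarrow> (\<exists>vs. tight_Hamilton_cycle V E vs)"
proof -
  define \<delta> where "\<delta> = min d 1"
  define \<beta> where "\<beta> = \<alpha> / 4"
  \<comment> \<open>The two entries are what \<open>many_connectors\<close> and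
    \<open>many_absorbers\<close> require.\<close>
  define \<kappa> where "\<kappa> = min (\<delta> ^ 10 / 2 ^ 21) (\<delta>\<^sup>2 * \<beta> ^ 3 / 2048)"
  have \<delta>: "0 < \<delta>" "\<delta> \<le> 1" "\<delta> \<le> d" and \<beta>: "0 < \<beta>"
    using assms unfolding \<delta>_def \<beta>_def by auto
  have \<kappa>: "0 < \<kappa>" "4 * \<kappa> \<le> \<delta> ^ 10 / 2 ^ 19" "8 * \<kappa> \<le> \<delta>\<^sup>2 * \<beta> ^ 3 / 256"
  proof -
    show "0 < \<kappa>" using \<delta> \<beta> unfolding \<kappa>_def by simp
    have "\<kappa> \<le> \<delta> ^ 10 / 2 ^ 21" "\<kappa> \<le> \<delta>\<^sup>2 * \<beta> ^ 3 / 2048"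
      unfolding \<kappa>_def by (rule min.cobounded1, rule min.cobounded2)
    then show "4 * \<kappa> \<le> \<delta> ^ 10 / 2 ^ 19" "8 * \<kappa> \<le> \<delta>\<^sup>2 * \<beta> ^ 3 / 256" by auto
  qed
  have "\<delta> ^ 10 \<le> 1" using \<delta> by (intro power_le_one) auto
  then have "\<kappa> < 1" using \<kappa>(2) by simp
  define q where "q = 1 - \<kappa> / 2"
  have q: "0 < q" "q < 1" unfolding q_def using \<kappa>(1) \<open>\<kappa> < 1\<close> by auto
  \<comment> \<open>The absorber family gets size about \<open>\<kappa> / 64 * n\<close>, small
    enough for both greedy selections; \<open>\<tau>\<close> is the resulting rate of
    absorption.\<close>
  have "0 < \<kappa> / 64" using \<kappa>(1) by simp
  from power_times_exponential_small[OF q this] obtain \<tau> where \<tau>: "0 < \<tau>"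
    "\<forall>\<^sub>F N in sequentially. real N ^ 4 * q ^ nat \<lfloor>\<kappa> / 64 * real N\<rfloor> \<le> (1 / 2) ^ nat \<lfloor>\<tau> * real N\<rfloor>" .
  \<comment> \<open>The reservoir is chosen after \<open>\<tau>\<close>: with
    \<open>\<mu> \<le> \<tau> / 16\<close> it has at most \<open>\<tau> / 4 * n\<close> vertices.
    Together with \<open>\<zeta> = \<tau> / 4\<close> the leftover is at most
    \<open>\<tau> / 2 * n\<close>, within the absorbing capacity.\<close>
  define \<mu> where "\<mu> = min (\<tau> / 16) (\<kappa> / 64)"
  have \<mu>: "0 < \<mu>" "\<mu> \<le> \<tau> / 16" "\<mu> \<le> \<kappa> / 64" unfolding \<mu>_def using \<tau>(1) \<kappa>(1) by auto
  from power_times_exponential_small[OF q \<mu>(1)] obtain \<tau>' where \<tau>': "0 < \<tau>'"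
    "\<forall>\<^sub>F N in sequentially. real N ^ 4 * q ^ nat \<lfloor>\<mu> * real N\<rfloor> \<le> (1 / 2) ^ nat \<lfloor>\<tau>' * real N\<rfloor>" .
  define \<zeta> where "\<zeta> = \<tau> / 4"
  have \<zeta>: "0 < \<zeta>" unfolding \<zeta>_def using \<tau>(1) by simp
  define K where "K = nat \<lceil>108 / (\<delta> * \<zeta> ^ 3)\<rceil>"
  define \<rho> where "\<rho> = min (min (\<delta> ^ 7 / 2 ^ 15) (\<delta> * \<beta>\<^sup>2 / 64))
    (min (\<delta> ^ 4 * \<beta> ^ 3 / 2 ^ 15) (\<delta> ^ 3 * \<zeta> ^ 3 / 110))"
  have \<rho>: "0 < \<rho>" "\<rho> \<le> \<delta> ^ 7 / 2 ^ 15" "\<rho> \<le> \<delta> * \<beta>\<^sup>2 / 64" "\<rho> \<le> \<delta> ^ 4 * \<beta> ^ 3 / 2 ^ 15"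
    "\<rho> \<le> \<delta> ^ 3 * \<zeta> ^ 3 / 110"
    using \<delta> \<beta> \<zeta> unfolding \<rho>_def by (simp, (meson min.cobounded1 min.cobounded2 order_trans)+)
  \<comment> \<open>Each summand secures one lower bound on \<open>n\<close>: for the binomial
    estimate, for \<open>1 \<le> 2 * \<kappa> * n\<close>, for rounding \<open>\<tau> * n\<close>,
    and for \<open>4 * K + 5\<close> reservoir hits.\<close>
  define B where "B = 2 + 1 / (2 * \<kappa>) + 2 / \<tau> + (4 * real K + 6) / \<tau>'"
  obtain n0 where n0: "\<And>N. n0 \<le> N \<Longrightarrow>
      real N ^ 4 * q ^ nat \<lfloor>\<kappa> / 64 * real N\<rfloor> \<le> (1 / 2) ^ nat \<lfloor>\<tau> * real N\<rfloor> \<and>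
      real N ^ 4 * q ^ nat \<lfloor>\<mu> * real N\<rfloor> \<le> (1 / 2) ^ nat \<lfloor>\<tau>' * real N\<rfloor>"
    using eventually_conj[OF \<tau>(2) \<tau>'(2)] unfolding eventually_sequentially by auto
  have "\<exists>vs. tight_Hamilton_cycle V E vs"
    if H: "uniform3_hypergraph V E" "max n0 (nat \<lceil>B\<rceil>) \<le> card V" "pair_pair_dense \<rho> d V E"
      "\<alpha> * real (card V choose 2) \<le> real (min_vertex_degree V E)" for V :: "'a set" and E
  proof -
    let ?n = "real (card V)"
    have terms: "0 \<le> 1 / (2 * \<kappa>)" "0 \<le> 2 / \<tau>" "0 \<le> (4 * real K + 6) / \<tau>'"
      using \<kappa>(1) \<tau>(1) \<tau>'(1) by auto
    have "B \<le> ?n" using H(2) by linarith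
    then have big: "2 \<le> ?n" "1 / (2 * \<kappa>) \<le> ?n" "2 / \<tau> \<le> ?n" "(4 * real K + 6) / \<tau>' \<le> ?n"
      using terms unfolding B_def by linarith+
    have n\<kappa>: "1 \<le> 2 * \<kappa> * ?n" using big(2) \<kappa>(1) by (simp add: divide_le_eq mult_ac)
    have n\<tau>: "2 \<le> \<tau> * ?n" using big(3) \<tau>(1) by (simp add: divide_le_eq mult_ac)
    have n\<tau>': "4 * real K + 6 \<le> \<tau>' * ?n" using big(4) \<tau>'(1) by (simp add: divide_le_eq mult_ac)
    have "V \<noteq> {}" using big(1) by auto
    then interpret cherry_dense V E \<delta> \<rho>
      using H(1) pair_pair_dense_mono[OF H(3) \<delta>(3)] \<delta> \<rho>(1) by unfold_locales auto
    let ?m = "nat \<lfloor>\<kappa> / 64 * ?n\<rfloor>" and ?r = "nat \<lfloor>\<mu> * ?n\<rfloor>" and ?k = "nat \<lfloor>\<tau> * ?n\<rfloor>"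
    have pos: "0 \<le> \<kappa> / 64 * ?n" "0 \<le> \<mu> * ?n" using \<kappa>(1) \<mu>(1) by auto
    have m: "real ?m \<le> \<kappa> / 64 * ?n" and r: "real ?r \<le> \<mu> * ?n" using pos by linarith+
    have \<mu>n: "\<mu> * ?n \<le> \<tau> / 16 * ?n" "\<mu> * ?n \<le> \<kappa> / 64 * ?n"
      using \<mu>(2,3) by (intro mult_right_mono; simp)+
    show ?thesis
    proof (rule Hamilton_cycle_from_parameters[where \<kappa> = \<kappa> and \<zeta> = \<zeta> and m = ?m and r = ?r and k = ?k and K = K])
      show "2 * \<kappa> * ?n ^ 4 \<le> real (card {t \<in> quads. distinct t \<and> tight_walk E (a # b # t @ [c, e])})"
        if "good a b" "good c e" for a b c e
        using many_connectors[OF \<rho>(2) \<kappa>(2) n\<kappa> that] .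
      show "2 * \<kappa> * ?n ^ 4 \<le> real (card {t \<in> quads. distinct t \<and> absorbs E v t \<and> good_ends good t})"
        if "v \<in> V" for v
      proof (rule many_absorbers[OF \<beta> \<rho>(3,4) \<kappa>(3) n\<kappa>])
        show "\<beta> * ?n\<^sup>2 \<le> real (card {(x, y). {v, x, y} \<in> E})"
          unfolding \<beta>_def using card_link_ge[OF H(1) that _ _ H(4)] big(1) assms(2) by simp
      qed
      \<comment> \<open>The absorber selection has only \<open>n\<close> indices; raising
        \<open>n\<close> to \<open>n ^ 4\<close> lets the same asymptotic bound serve both
        selections.\<close>
      have "?n * q ^ ?m \<le> ?n ^ 4 * q ^ ?m"
        using big(1) q(1) self_le_power[of ?n 4] by (intro mult_right_mono) auto
      also have "\<dots> \<le> (1 / 2) ^ ?k" using n0 H(2) by simp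
      finally show "?n * (1 - \<kappa> / 2) ^ ?m \<le> (1 / 2) ^ ?k" unfolding q_def .
      have "?n ^ 4 * q ^ ?r \<le> (1 / 2) ^ nat \<lfloor>\<tau>' * ?n\<rfloor>" using n0 H(2) by simp
      also have "4 * K + 5 \<le> nat \<lfloor>\<tau>' * ?n\<rfloor>" using n\<tau>' by linarith
      then have "(1 / 2 :: real) ^ nat \<lfloor>\<tau>' * ?n\<rfloor> \<le> (1 / 2) ^ (4 * K + 5)"
        by (intro power_decreasing) auto
      finally show "?n ^ 4 * (1 - \<kappa> / 2) ^ ?r \<le> (1 / 2) ^ (4 * K + 5)" unfolding q_def .
      show "4 * (8 * real ?m + 4 * real ?r) \<le> \<kappa> * ?n"
        using m r \<mu>n(2) pos(1) by (simp add: field_simps)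
      have "\<tau> * ?n - 1 \<le> real ?k" by linarith
      then show "\<zeta> * ?n + 4 * real ?r \<le> real ?k"
        using r \<mu>n(1) n\<tau> unfolding \<zeta>_def by (simp add: field_simps)
      show "108 / (\<delta> * \<zeta> ^ 3) \<le> real K" unfolding K_def by (rule of_nat_ceiling)
    qed (use \<kappa>(1) \<zeta> \<rho>(5) in auto)
  qed
  then show ?thesis
    using \<rho>(1) by (intro exI[of _ \<rho>] conjI exI[of _ "max n0 (nat \<lceil>B\<rceil>)"]) auto
qed

end
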